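(* Let $\mathcal{H}$ be a complex Hilbert space, let $A \in \mathscr{B}(\mathcal{H})$ be a normal operator and let $g \in \mathcal{H}$. If $A$ is $\mathcal{K}(A,g)$-reduced, then the map $$L^2(\sigma(A), \mu_g^{(A)}) \longrightarrow \overline{\mathcal{K}(A,g)}, \qquad f \longmapsto f(A) g,$$ is an isomorphism (a well-defined linear bijection), where $f(A) := \int_{\sigma(A)} f(z)\, \mathrm{d}E^{(A)}(z)$ is understood in terms of the spectral functional calculus.
   Context: $\mathscr{B}(\mathcal{H})$ denotes the bounded everywhere defined linear operators on $\mathcal{H}$, and bars over subspaces denote norm closure in $\mathcal{H}$. For $A \in \mathscr{B}(\mathcal{H})$ and $g \in \mathcal{H}$ the Krylov subspace is $\mathcal{K}(A,g) := \mathrm{span}\{A^k g \mid k \in \mathbb{N}_0\}$. $A$ is called $\mathcal{K}(A,g)$-reduced if both $\overline{\mathcal{K}(A,g)}$ and $\mathcal{K}(A,g)^\perp$ are invariant under $A$, i.e. $A\,\overline{\mathcal{K}(A,g)} \subset \overline{\mathcal{K}(A,g)}$ and $A\,\mathcal{K}(A,g)^\perp \subset \mathcal{K}(A,g)^\perp$. For a normal operator $A \in \mathscr{B}(\mathcal{H})$, $E^{(A)}$ denotes its unique projection-valued spectral measure (supported on $\sigma(A)$), and $\mu_g^{(A)}(\Omega) = \langle E^{(A)}(\Omega) g, g\rangle$ for Borel $\Omega \subset \mathbb{C}$ is the associated scalar measure. For $f \in L^2(\sigma(A), \mu_g^{(A)})$, $f(A)$ is in general an unbounded operator, and $g$ lies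 in its domain. *)

theory Defs
  imports "HOL-Analysis.Analysis"
begin

section \<open>Complex Hilbert spaces\<close>

class scaleC = scaleR +
  fixes scaleC :: "complex \<Rightarrow> 'a \<Rightarrow> 'a" (infixr "*\<^sub>C" 75)
  assumes scaleR_scaleC: "scaleR r x = scaleC (complex_of_real r) x"

class complex_vector = scaleC + ab_group_add +
  assumes scaleC_add_right: "a *\<^sub>C (x + y) = a *\<^sub>C x + a *\<^sub>C y"
    and scaleC_add_left: "(a + b) *\<^sub>C x = a *\<^sub>C x + b *\<^sub>C x"
    and scaleC_scaleC: "a *\<^sub>C b *\<^sub>C x = (a * b) *\<^sub>C x"
    and scaleC_one: "1 *\<^sub>C x = x"

global_interpretation complex_vector: vector_space "scaleC :: complex \<Rightarrow> 'a \<Rightarrow> 'a::complex_vector"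
  defines cspan = complex_vector.span
  by unfold_locales (simp_all add: scaleC_add_right scaleC_add_left scaleC_scaleC scaleC_one)

text \<open>The inner product is antilinear in the first and linear in the second argument.\<close>

class complex_inner = complex_vector + real_normed_vector +
  fixes cinner :: "'a \<Rightarrow> 'a \<Rightarrow> complex"
  assumes cinner_commute: "cinner x y = cnj (cinner y x)"
    and cinner_add_right: "cinner x (y + z) = cinner x y + cinner x z"
    and cinner_scaleC_right: "cinner x (c *\<^sub>C y) = c * cinner x y"
    and norm_power2_cinner: "complex_of_real ((norm x)\<^sup>2) = cinner x x"

class chilbert_space = complex_inner + complete_space


section \<open>Bounded operators\<close>

definition bounded_clinear :: "('a::complex_inner \<Rightarrow> 'b::complex_inner) \<Rightarrow> bool" where
  "bounded_clinear T \<longleftrightarrow> bounded_linear T \<and> (\<forall>c x. T (c *\<^sub>C x) = c *\<^sub>C T x)"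

definition cadjoint :: "('a::complex_inner \<Rightarrow> 'b::complex_inner) \<Rightarrow> 'b \<Rightarrow> 'a" where
  "cadjoint T = (THE T'. \<forall>x y. cinner (T x) y = cinner x (T' y))"

definition normal_operator :: "('a::complex_inner \<Rightarrow> 'a) \<Rightarrow> bool" where
  "normal_operator T \<longleftrightarrow> bounded_clinear T \<and> T \<circ> cadjoint T = cadjoint T \<circ> T"

definition spectrum :: "('a::complex_inner \<Rightarrow> 'a) \<Rightarrow> complex set" where
  "spectrum T = {z. \<not> (\<exists>R. bounded_clinear R \<and>
      (\<forall>x. R (T x - z *\<^sub>C x) = x) \<and> (\<forall>x. T (R x) - z *\<^sub>C R x = x))}"


section \<open>Krylov subspaces\<close>

definition krylov :: "('a::complex_inner \<Rightarrow> 'a) \<Rightarrow> 'a \<Rightarrow> 'a set" where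
  "krylov A g = cspan {(A ^^ k) g | k. True}"

definition ortho_complement :: "'a::complex_inner set \<Rightarrow> 'a set" where
  "ortho_complement S = {x. \<forall>y\<in>S. cinner x y = 0}"

definition krylov_reduced :: "('a::complex_inner \<Rightarrow> 'a) \<Rightarrow> 'a \<Rightarrow> bool" where
  "krylov_reduced A g \<longleftrightarrow>
     A ` closure (krylov A g) \<subseteq> closure (krylov A g) \<and>
     A ` ortho_complement (krylov A g) \<subseteq> ortho_complement (krylov A g)"


section \<open>Projection-valued measures and the spectral functional calculus\<close>

definition orthogonal_projection :: "('a::complex_inner \<Rightarrow> 'a) \<Rightarrow> bool" where
  "orthogonal_projection P \<longleftrightarrow>
     bounded_clinear P \<and> P \<circ> P = P \<and> (\<forall>x y. cinner (P x) y = cinner x (P y))"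

text \<open>Countable additivity is with respect to the strong operator topology.\<close>

definition projection_valued_measure :: "(complex set \<Rightarrow> 'a::complex_inner \<Rightarrow> 'a) \<Rightarrow> bool" where
  "projection_valued_measure E \<longleftrightarrow>
     (\<forall>\<Omega>\<in>sets borel. orthogonal_projection (E \<Omega>)) \<and>
     E UNIV = id \<and>
     (\<forall>F::nat \<Rightarrow> complex set. range F \<subseteq> sets borel \<longrightarrow> disjoint_family F \<longrightarrow>
        (\<forall>x. (\<lambda>n. E (F n) x) sums E (\<Union>n. F n) x))"

definition scalar_measure :: "(complex set \<Rightarrow> 'a::complex_inner \<Rightarrow> 'a) \<Rightarrow> 'a \<Rightarrow> complex measure" where
  "scalar_measure E x = measure_of UNIV (sets borel) (\<lambda>\<Omega>. ennreal (Re (cinner (E \<Omega> x) x)))"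

abbreviation scalar_measure_on ::
    "complex set \<Rightarrow> (complex set \<Rightarrow> 'a::complex_inner \<Rightarrow> 'a) \<Rightarrow> 'a \<Rightarrow> complex measure" where
  "scalar_measure_on S E x \<equiv> restrict_space (scalar_measure E x) S"

definition simple_spectral_integral ::
    "complex set \<Rightarrow> (complex set \<Rightarrow> 'a::complex_inner \<Rightarrow> 'a) \<Rightarrow> (complex \<Rightarrow> complex) \<Rightarrow> 'a \<Rightarrow> 'a" where
  "simple_spectral_integral S E s x = (\<Sum>c\<in>s ` S. c *\<^sub>C E (s -` {c} \<inter> S) x)"

text \<open>\<open>has_spectral_integral S E f x y\<close> says that \<open>(\<integral>\<^sub>S f dE) x = y\<close>. For simple \<open>s\<close> one has
  \<open>\<parallel>(\<integral>\<^sub>S s dE) x\<parallel>\<^sup>2 = \<integral>\<^sub>S \<bar>s\<bar>\<^sup>2 d\<mu>\<^sub>x\<close>, and the integral of a general Borel function is the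
  extension of this isometry by approximation in \<open>L\<^sup>2(S, \<mu>\<^sub>x)\<close>. As functions only matter
  on \<open>S\<close>, measurability and approximation refer to the measure restricted to \<open>S\<close>.\<close>

definition has_spectral_integral ::
    "complex set \<Rightarrow> (complex set \<Rightarrow> 'a::complex_inner \<Rightarrow> 'a) \<Rightarrow> (complex \<Rightarrow> complex) \<Rightarrow> 'a \<Rightarrow> 'a \<Rightarrow> bool" where
  "has_spectral_integral S E f x y \<longleftrightarrow>
     f \<in> borel_measurable (restrict_space borel S) \<and>
     (\<exists>s. (\<forall>n. simple_function (restrict_space borel S) (s n)) \<and>
       (\<lambda>n. \<integral>\<^sup>+z. ennreal ((cmod (f z - s n z))\<^sup>2) \<partial>scalar_measure_on S E x) \<longlonglongrightarrow> 0 \<and>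
       (\<lambda>n. simple_spectral_integral S E (s n) x) \<longlonglongrightarrow> y)"

definition spectral_measure_of ::
    "('a::complex_inner \<Rightarrow> 'a) \<Rightarrow> (complex set \<Rightarrow> 'a \<Rightarrow> 'a) \<Rightarrow> bool" where
  "spectral_measure_of A E \<longleftrightarrow>
     projection_valued_measure E \<and> E (spectrum A) = id \<and>
     (\<forall>x. has_spectral_integral (spectrum A) E (\<lambda>z. z) x (A x))"

text \<open>The (in general unbounded) operator \<open>f(A) = \<integral>\<^bsub>\<sigma>(A)\<^esub> f dE\<close> consists of its domain
  and its action; the latter is meaningful on the domain only.\<close>

definition spectral_calculus_domain ::
    "('a::complex_inner \<Rightarrow> 'a) \<Rightarrow> (complex set \<Rightarrow> 'a \<Rightarrow> 'a) \<Rightarrow> (complex \<Rightarrow> complex) \<Rightarrow> 'a set" where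
  "spectral_calculus_domain A E f =
     {x. (\<integral>\<^sup>+z. ennreal ((cmod (f z))\<^sup>2) \<partial>scalar_measure_on (spectrum A) E x) < \<infinity>}"

definition spectral_calculus ::
    "('a::complex_inner \<Rightarrow> 'a) \<Rightarrow> (complex set \<Rightarrow> 'a \<Rightarrow> 'a) \<Rightarrow> (complex \<Rightarrow> complex) \<Rightarrow> 'a \<Rightarrow> 'a" where
  "spectral_calculus A E f x = (THE y. has_spectral_integral (spectrum A) E f x y)"


section \<open>The space of square-integrable functions modulo equality almost everywhere\<close>

definition L2_fun :: "'b measure \<Rightarrow> ('b \<Rightarrow> complex) set" where
  "L2_fun M = {f \<in> borel_measurable M. integrable M (\<lambda>z. (cmod (f z))\<^sup>2)}"

definition L2_rel :: "'b measure \<Rightarrow> (('b \<Rightarrow> complex) \<times> ('b \<Rightarrow> complex)) set" where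
  "L2_rel M = {(f, h). f \<in> L2_fun M \<and> h \<in> L2_fun M \<and> (AE z in M. f z = h z)}"

definition L2_space :: "'b measure \<Rightarrow> ('b \<Rightarrow> complex) set set" where
  "L2_space M = L2_fun M // L2_rel M"

definition L2_add :: "'b measure \<Rightarrow> ('b \<Rightarrow> complex) set \<Rightarrow> ('b \<Rightarrow> complex) set \<Rightarrow> ('b \<Rightarrow> complex) set" where
  "L2_add M F H = (\<Union>f\<in>F. \<Union>h\<in>H. L2_rel M `` {\<lambda>z. f z + h z})"

definition L2_scale :: "'b measure \<Rightarrow> complex \<Rightarrow> ('b \<Rightarrow> complex) set \<Rightarrow> ('b \<Rightarrow> complex) set" where
  "L2_scale M c F = (\<Union>f\<in>F. L2_rel M `` {\<lambda>z. c * f z})"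

text \<open>The map \<open>f \<mapsto> f(A) g\<close> on classes. \<^const>\<open>the_elem\<close> returns the common value on all
  representatives, provided that there is one.\<close>

definition calculus_map ::
    "('a::complex_inner \<Rightarrow> 'a) \<Rightarrow> (complex set \<Rightarrow> 'a \<Rightarrow> 'a) \<Rightarrow> 'a \<Rightarrow> (complex \<Rightarrow> complex) set \<Rightarrow> 'a" where
  "calculus_map A E g F = the_elem ((\<lambda>f. spectral_calculus A E f g) ` F)"

end

theory Submission
  imports Defs
begin

text \<open>For \<open>\<mu>\<close> the scalar measure of \<open>g\<close>, the map \<open>f \<mapsto> f(A) g\<close> is an isometry on
  \<open>L\<^sup>2(\<mu>)\<close>, so it is injective with closed range. The range contains \<open>A\<^sup>k g\<close>, the image of
  \<open>z\<^sup>k\<close>, hence the closure \<open>M\<close> of the Krylov subspace. Conversely, \<open>M\<close> is invariant under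
  \<open>A\<close> and, because its orthogonal complement is invariant under \<open>A\<close>, also under the adjoint
  of \<open>A\<close>. So the functions \<open>f\<close> with \<open>f(A) g \<in> M\<close> form a closed subspace that is stable under
  multiplication by \<open>z\<close> and by its conjugate. It contains the polynomials in the real and
  imaginary part, by Stone-Weierstrass the continuous functions on the compact spectrum, then
  the indicators of open and, by Dynkin's lemma, of Borel sets, and finally all of \<open>L\<^sup>2(\<mu>)\<close>.\<close>

section \<open>Geometry of complex Hilbert spaces\<close>

text \<open>The main obstacle is that \<open>(\<integral> f dE) x\<close> is defined by
  approximation in \<open>L\<^sup>2(\<mu>\<^sub>x)\<close>, a space that changes with
  \<open>x\<close>. Multiplicativity compares two such spaces: \<open>(f h)(A) x\<close> lives over
  \<mu> of \<open>x\<close>, whereas applying \<open>f(A)\<close> to \<open>h(A) x\<close> lives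
  over \<mu> of \<open>h(A) x\<close>. It is therefore proved for bounded \<open>f\<close> only,
  whose simple approximants are uniformly bounded and converge pointwise, hence in both spaces at
  once. The multipliers \<open>z\<close> and \<open>cnj z\<close> are bounded because the spectrum
  is, and no others are needed. The adjoint of \<open>A\<close> enters as the integral of
  \<open>cnj\<close>, so that multiplication by \<open>cnj z\<close> falls under the same rule. The
  step from indicators to an unbounded \<open>f\<close> needs no truncation: membership of the
  indicators says that every \<open>E \<Omega> g\<close> lies in \<open>M\<close>, and
  \<open>f(A) g\<close> is by definition a limit of linear combinations of such vectors.\<close>

lemma cinner_add_left: "cinner (x + y) z = cinner x z + cinner y z"
  by (metis cinner_add_right cinner_commute complex_cnj_add)

lemma cinner_scaleC_left: "cinner (c *\<^sub>C x) y = cnj c * cinner x y"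
  by (metis cinner_commute cinner_scaleC_right complex_cnj_mult)

lemma cinner_zero_right [simp]: "cinner x 0 = 0"
  using cinner_add_right[of x 0 0] by simp

lemma cinner_zero_left [simp]: "cinner 0 x = 0"
  by (metis cinner_commute cinner_zero_right complex_cnj_zero)

lemma cinner_minus_right: "cinner x (- y) = - cinner x y"
  using cinner_add_right[of x y "- y"] by (simp add: add_eq_0_iff)

lemma cinner_minus_left: "cinner (- x) y = - cinner x y"
  by (metis cinner_commute cinner_minus_right complex_cnj_minus)

lemma cinner_diff_left: "cinner (x - y) z = cinner x z - cinner y z"
  using cinner_add_left[of x "- y" z] by (simp add: cinner_minus_left)

lemma cinner_sum_left: "cinner (sum f I) y = (\<Sum>i\<in>I. cinner (f i) y)"
  by (induction I rule: infinite_finite_induct) (simp_all add: cinner_add_left)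

lemma cinner_sum_right: "cinner y (sum f I) = (\<Sum>i\<in>I. cinner y (f i))"
  by (induction I rule: infinite_finite_induct) (simp_all add: cinner_add_right)

lemma power2_norm_eq_Re_cinner: "(norm x)\<^sup>2 = Re (cinner x x)"
  by (metis Re_complex_of_real norm_power2_cinner)

lemma power2_norm_add: "(norm (x + y))\<^sup>2 = (norm x)\<^sup>2 + (norm y)\<^sup>2 + 2 * Re (cinner x y)"
proof -
  have "Re (cinner y x) = Re (cinner x y)"
    by (metis cinner_commute complex_cnj cnj.sel(1))
  then show ?thesis
    by (simp add: power2_norm_eq_Re_cinner cinner_add_left cinner_add_right)
qed

lemma norm_scaleC [simp]:
  fixes x :: "'a::complex_inner"
  shows "norm (c *\<^sub>C x) = cmod c * norm x"
proof -
  have "complex_of_real ((norm (c *\<^sub>C x))\<^sup>2) = complex_of_real ((cmod c * norm x)\<^sup>2)"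
    unfolding norm_power2_cinner cinner_scaleC_left cinner_scaleC_right power_mult_distrib
      of_real_mult complex_norm_square
    by (simp add: algebra_simps flip: norm_power2_cinner)
  then show ?thesis
    by (metis norm_ge_zero of_real_eq_iff power2_eq_imp_eq zero_le_mult_iff)
qed

lemma bounded_bilinear_scaleC:
  "bounded_bilinear (scaleC :: complex \<Rightarrow> 'a \<Rightarrow> 'a::complex_inner)"
  by standard
    (auto simp: scaleC_add_left scaleC_add_right scaleR_scaleC scaleC_scaleC scaleR_conv_of_real
      algebra_simps intro!: exI[of _ 1])

lemmas tendsto_scaleC [tendsto_intros] = bounded_bilinear.tendsto[OF bounded_bilinear_scaleC]
lemmas bounded_linear_scaleC_right = bounded_bilinear.bounded_linear_right[OF bounded_bilinear_scaleC]

text \<open>Cauchy-Schwarz: subtracting from \<open>x\<close> its projection onto the line through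
  \<open>y\<close> lowers the squared norm by \<open>(cmod a)\<^sup>2 / (norm y)\<^sup>2\<close>,
  and the result is still nonnegative.\<close>

lemma norm_cinner_le: "cmod (cinner x y) \<le> norm x * norm y"
proof (cases "y = 0")
  case False
  define a where "a = cinner y x"
  have a': "cinner x y = cnj a"
    unfolding a_def by (rule cinner_commute)
  have "0 \<le> (norm (x + (- (a / of_real ((norm y)\<^sup>2))) *\<^sub>C y))\<^sup>2"
    by simp
  also have "\<dots> = (norm x)\<^sup>2 - (cmod a)\<^sup>2 / (norm y)\<^sup>2"
  proof -
    have "Re (a * cnj a) = (cmod a)\<^sup>2"
      by (metis Re_complex_of_real complex_norm_square)
    with False show ?thesis
      unfolding power2_norm_add cinner_scaleC_right a' norm_scaleC
      by (simp add: norm_divide norm_power power_divide Re_divide_of_real field_simps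
          power2_eq_square flip: of_real_power of_real_mult)
  qed
  finally have "(cmod a)\<^sup>2 \<le> (norm x * norm y)\<^sup>2"
    using False by (simp add: field_simps)
  then have "cmod a \<le> norm x * norm y"
    by (rule power2_le_imp_le) simp
  then show ?thesis
    by (simp add: a')
qed simp

lemma bounded_bilinear_cinner: "bounded_bilinear cinner"
proof
  show "\<exists>K. \<forall>x y. cmod (cinner x y) \<le> norm x * norm y * K"
    by (intro exI[of _ 1]) (simp add: norm_cinner_le)
qed (simp_all add: cinner_add_left cinner_add_right scaleR_scaleC cinner_scaleC_left
      cinner_scaleC_right scaleR_conv_of_real)

lemmas tendsto_cinner [tendsto_intros] = bounded_bilinear.tendsto[OF bounded_bilinear_cinner]

section \<open>Nearest points and orthogonal complements\<close>

lemma parallelogram_law: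
  fixes x y :: "'a::complex_inner"
  shows "(norm (x + y))\<^sup>2 + (norm (x - y))\<^sup>2 = 2 * (norm x)\<^sup>2 + 2 * (norm y)\<^sup>2"
  using power2_norm_add[of x y] power2_norm_add[of x "- y"] by (simp add: cinner_minus_right)

text \<open>Continuity of the inner product. \<open>krylov_reduced\<close> speaks of the complement
  of the span itself, whereas the double complement argument is applied to its closure.\<close>

lemma ortho_complement_closure: "ortho_complement (closure S) = ortho_complement S"
proof
  show "ortho_complement S \<subseteq> ortho_complement (closure S)"
  proof
    fix x assume x: "x \<in> ortho_complement S"
    show "x \<in> ortho_complement (closure S)"
      unfolding ortho_complement_def
    proof (intro CollectI ballI)
      fix y assume "y \<in> closure S"
      then obtain u where u: "\<forall>n. u n \<in> S" "u \<longlonglongrightarrow> y"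
        by (auto simp: closure_sequential)
      then have "(\<lambda>n. cinner x (u n)) \<longlonglongrightarrow> cinner x y"
        by (intro tendsto_intros)
      moreover have "cinner x (u n) = 0" for n
        using x u(1) by (simp add: ortho_complement_def)
      ultimately show "cinner x y = 0"
        by (simp add: LIMSEQ_const_iff)
    qed
  qed
qed (use closure_subset in \<open>auto simp: ortho_complement_def\<close>)

lemma subspace_closure:
  fixes S :: "'a::complex_inner set"
  assumes "complex_vector.subspace S"
  shows "complex_vector.subspace (closure S)"
proof (rule complex_vector.subspaceI)
  show "0 \<in> closure S"
    using assms closure_subset complex_vector.subspace_0 by blast
next
  fix x y assume "x \<in> closure S" "y \<in> closure S"
  then obtain u v where "\<forall>n. u n \<in> S" "u \<longlonglongrightarrow> x" "\<forall>n. v n \<in> S" "v \<longlonglongrightarrow> y"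
    by (auto simp: closure_sequential)
  then have "\<forall>n. u n + v n \<in> S" "(\<lambda>n. u n + v n) \<longlonglongrightarrow> x + y"
    using assms by (auto intro: tendsto_add complex_vector.subspace_add)
  then show "x + y \<in> closure S"
    unfolding closure_sequential by (intro exI[of _ "\<lambda>n. u n + v n"]) simp
next
  fix c x assume "x \<in> closure S"
  then obtain u where "\<forall>n. u n \<in> S" "u \<longlonglongrightarrow> x"
    by (auto simp: closure_sequential)
  then have "\<forall>n. c *\<^sub>C u n \<in> S" "(\<lambda>n. c *\<^sub>C u n) \<longlonglongrightarrow> c *\<^sub>C x"
    using assms by (auto intro!: tendsto_intros complex_vector.subspace_scale)
  then show "c *\<^sub>C x \<in> closure S"
    unfolding closure_sequential by (intro exI[of _ "\<lambda>n. c *\<^sub>C u n"]) simp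
qed

text \<open>If \<open>w\<close> were not orthogonal to some \<open>u\<close>, removing its component
  along \<open>u\<close> would give a vector \<open>w - u'\<close> with \<open>u'\<close> in
  \<open>M\<close> and strictly smaller norm.\<close>

lemma closest_point_ortho:
  assumes M: "complex_vector.subspace M"
    and min: "\<And>u. u \<in> M \<Longrightarrow> norm w \<le> norm (w - u)"
  shows "w \<in> ortho_complement M"
  unfolding ortho_complement_def
proof (intro CollectI ballI, rule ccontr)
  fix u assume u: "u \<in> M" and ne: "cinner w u \<noteq> 0"
  then have "u \<noteq> 0"
    by auto
  define a where "a = cinner u w"
  have wu: "cinner w u = cnj a"
    unfolding a_def by (rule cinner_commute)
  define c where "c = - (a / of_real ((norm u)\<^sup>2))"
  have "(norm (w + c *\<^sub>C u))\<^sup>2 = (norm w)\<^sup>2 - (cmod a)\<^sup>2 / (norm u)\<^sup>2"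
  proof -
    have "Re (a * cnj a) = (cmod a)\<^sup>2"
      by (metis Re_complex_of_real complex_norm_square)
    with \<open>u \<noteq> 0\<close> show ?thesis
      unfolding power2_norm_add cinner_scaleC_right wu norm_scaleC c_def
      by (simp add: norm_divide norm_power power_divide Re_divide_of_real field_simps
          power2_eq_square flip: of_real_power of_real_mult)
  qed
  also have "\<dots> < (norm w)\<^sup>2"
    using ne wu \<open>u \<noteq> 0\<close> by simp
  finally have "norm (w - (- c) *\<^sub>C u) < norm w"
    by (simp add: power_less_imp_less_base)
  with min[of "(- c) *\<^sub>C u"] M u show False
    by (meson complex_vector.subspace_scale not_less)
qed

text \<open>The parallelogram law makes every minimizing sequence Cauchy, and completeness supplies
  its limit.\<close>

lemma ex_closest_point:
  fixes M :: "'a::chilbert_space set"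
  assumes M: "complex_vector.subspace M" and cl: "closed M"
  shows "\<exists>m\<in>M. \<forall>u\<in>M. norm (x - m) \<le> norm (x - u)"
proof -
  have ne: "M \<noteq> {}"
    using complex_vector.subspace_0[OF M] by auto
  define d where "d = infdist x M"
  have d_le: "d \<le> norm (x - u)" if "u \<in> M" for u
    using infdist_le[OF that, of x] by (simp add: d_def dist_norm)
  have d0: "0 \<le> d"
    by (simp add: d_def infdist_nonneg)
  have "\<exists>u\<in>M. norm (x - u) < d + 1 / real (Suc n)" for n
  proof (rule ccontr)
    assume "\<not> ?thesis"
    then have "d + 1 / real (Suc n) \<le> (INF u\<in>M. dist x u)"
      using ne by (intro cINF_greatest) (auto simp: dist_norm not_less)
    then show False
      using ne by (simp add: d_def infdist_def)
  qed
  then obtain u where uM: "\<And>n. u n \<in> M" and u: "\<And>n. norm (x - u n) < d + 1 / real (Suc n)"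
    by metis
  have lim: "(\<lambda>n. norm (x - u n)) \<longlonglongrightarrow> d"
  proof (rule tendsto_sandwich[where f = "\<lambda>_. d"])
    show "\<forall>\<^sub>F n in sequentially. norm (x - u n) \<le> d + 1 / real (Suc n)"
      using u by (intro always_eventually allI less_imp_le)
    show "(\<lambda>n. d + 1 / real (Suc n)) \<longlonglongrightarrow> d"
      using tendsto_add[OF tendsto_const LIMSEQ_Suc[OF lim_1_over_n], of d] by simp
  qed (use d_le uM in auto)
  have par: "(norm (u m - u n))\<^sup>2 \<le> 2 * (norm (x - u m))\<^sup>2 + 2 * (norm (x - u n))\<^sup>2 - 4 * d\<^sup>2"
    for m n
  proof -
    \<comment> \<open>The midpoint lies in \<open>M\<close>, so its distance from \<open>x\<close>
      is at least \<open>d\<close>; this is where the term \<open>4 * d\<^sup>2\<close> comes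
      from.\<close>
    define v where "v = (1/2 :: complex) *\<^sub>C (u m + u n)"
    have "v \<in> M"
      unfolding v_def using M uM
      by (simp add: complex_vector.subspace_add complex_vector.subspace_scale)
    have "(x - u m) + (x - u n) = (2::complex) *\<^sub>C (x - v)"
    proof -
      have "(2::complex) *\<^sub>C x = x + x"
        using scaleC_add_left[of 1 1 x] by (simp add: scaleC_one)
      then show ?thesis
        by (simp add: v_def complex_vector.scale_right_diff_distrib scaleC_scaleC scaleC_one)
    qed
    then have "norm ((x - u m) + (x - u n)) = 2 * norm (x - v)"
      by simp
    moreover have "d\<^sup>2 \<le> (norm (x - v))\<^sup>2"
      using d_le[OF \<open>v \<in> M\<close>] d0 by (intro power_mono)
    ultimately show ?thesis
      using parallelogram_law[of "x - u m" "x - u n"]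
      by (simp add: norm_minus_commute power_mult_distrib)
  qed
  have "Cauchy u"
  proof (rule CauchyI)
    fix e :: real assume "e > 0"
    have "(\<lambda>n. (norm (x - u n))\<^sup>2) \<longlonglongrightarrow> d\<^sup>2"
      by (intro tendsto_intros lim)
    \<comment> \<open>Each of the two squared distances enters \<open>par\<close> with factor 2, so
      an excess below \<open>e\<^sup>2 / 4\<close> in both leaves less than
      \<open>e\<^sup>2\<close>.\<close>
    then obtain N where "\<And>n. n \<ge> N \<Longrightarrow> norm ((norm (x - u n))\<^sup>2 - d\<^sup>2) < e\<^sup>2 / 4"
      using LIMSEQ_D \<open>e > 0\<close> by (metis divide_pos_pos zero_less_numeral zero_less_power)
    then have N: "\<And>n. n \<ge> N \<Longrightarrow> (norm (x - u n))\<^sup>2 - d\<^sup>2 < e\<^sup>2 / 4"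
      unfolding real_norm_def by (meson abs_ge_self le_less_trans)
    show "\<exists>N. \<forall>m\<ge>N. \<forall>n\<ge>N. norm (u m - u n) < e"
    proof (intro exI allI impI)
      fix m n assume "m \<ge> N" "n \<ge> N"
      then have "(norm (u m - u n))\<^sup>2 < e\<^sup>2"
        using par[of m n] N[of m] N[of n] by linarith
      then show "norm (u m - u n) < e"
        using \<open>e > 0\<close> by (simp add: power_less_imp_less_base)
    qed
  qed
  then obtain m where m: "u \<longlonglongrightarrow> m"
    using Cauchy_convergent convergent_def by blast
  have "m \<in> M"
    using closed_sequentially[OF cl] uM m by blast
  moreover have "norm (x - m) = d"
    by (rule LIMSEQ_unique[OF _ lim]) (intro tendsto_intros m)
  ultimately show ?thesis
    using d_le by blast
qed

text \<open>For the nearest point \<open>m\<close>, the vector \<open>x - m\<close> is in the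
  complement, hence orthogonal to \<open>x\<close> by assumption and to \<open>m\<close>, hence to
  itself.\<close>

lemma double_ortho_complement:
  fixes M :: "'a::chilbert_space set"
  assumes M: "complex_vector.subspace M" and cl: "closed M"
    and x: "\<And>w. w \<in> ortho_complement M \<Longrightarrow> cinner x w = 0"
  shows "x \<in> M"
proof -
  obtain m where m: "m \<in> M" and min: "\<And>u. u \<in> M \<Longrightarrow> norm (x - m) \<le> norm (x - u)"
    using ex_closest_point[OF M cl] by metis
  have w: "x - m \<in> ortho_complement M"
  proof (rule closest_point_ortho[OF M])
    fix u assume "u \<in> M"
    with min[of "m + u"] m M show "norm (x - m) \<le> norm (x - m - u)"
      by (simp add: complex_vector.subspace_add diff_diff_eq)
  qed
  then have "cinner (x - m) m = 0"
    using m by (simp add: ortho_complement_def)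
  then have "cinner m (x - m) = 0"
    by (metis cinner_commute complex_cnj_zero)
  with x[OF w] have "cinner (x - m) (x - m) = 0"
    by (simp add: cinner_diff_left)
  then have "x - m = 0"
    using power2_norm_eq_Re_cinner[of "x - m"] by simp
  with m show ?thesis
    by simp
qed


section \<open>The spectrum is compact\<close>

lemma bounded_clinear_add: "bounded_clinear T \<Longrightarrow> T (x + y) = T x + T y"
  by (simp add: bounded_clinear_def bounded_linear.linear linear_add)

lemma bounded_clinear_diff: "bounded_clinear T \<Longrightarrow> T (x - y) = T x - T y"
  by (simp add: bounded_clinear_def bounded_linear.linear linear_diff)

lemma bounded_clinear_scaleC: "bounded_clinear T \<Longrightarrow> T (c *\<^sub>C x) = c *\<^sub>C T x"
  by (simp add: bounded_clinear_def)

lemma bounded_clinear_comp: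
  assumes "bounded_clinear S" "bounded_clinear T"
  shows "bounded_clinear (\<lambda>x. S (T x))"
  using assms bounded_linear_compose[of S T] by (simp add: bounded_clinear_def)

lemma bounded_clinear_scale:
  assumes "bounded_clinear T"
  shows "bounded_clinear (\<lambda>x. c *\<^sub>C T x)"
  using assms bounded_linear_compose[OF bounded_linear_scaleC_right, of T c]
  by (simp add: bounded_clinear_def scaleC_scaleC mult.commute)

text \<open>The inverse of \<open>I - C\<close> is obtained from Banach's fixed point theorem for
  \<open>x \<mapsto> y + C x\<close> instead of from the geometric series; uniqueness of the fixed
  point gives linearity and both inverse laws.\<close>

lemma neumann_inverse:
  fixes C :: "'a::chilbert_space \<Rightarrow> 'a"
  assumes C: "bounded_clinear C" and le: "\<And>x. norm (C x) \<le> q * norm x" and q: "q < 1"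
  shows "\<exists>N. bounded_clinear N \<and> (\<forall>x. N (x - C x) = x) \<and> (\<forall>x. N x - C (N x) = x)"
proof -
  \<comment> \<open>The contraction theorem wants a constant that is at least 0, and
    \<open>q\<close> may be negative.\<close>
  have q': "norm (C x) \<le> max 0 q * norm x" for x
    by (rule order.trans[OF le mult_right_mono]) auto
  have ex1: "\<exists>!x. y + C x = x" for y
  proof -
    have "\<forall>x z. dist (y + C x) (y + C z) \<le> max 0 q * dist x z"
      using q' by (simp add: dist_norm flip: bounded_clinear_diff[OF C])
    with q show ?thesis
      by (intro banach_fix_type[of "max 0 q"]) auto
  qed
  define N where "N y = (THE x. y + C x = x)" for y
  have N: "y + C (N y) = N y" for y
    unfolding N_def using theI'[OF ex1] .
  have uniq: "N y = x" if "y + C x = x" for x y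
    using ex1[of y] N[of y] that by blast
  have scale: "N (c *\<^sub>C x) = c *\<^sub>C N x" for c x
  proof (rule uniq)
    have "c *\<^sub>C x + C (c *\<^sub>C N x) = c *\<^sub>C (x + C (N x))"
      by (simp only: bounded_clinear_scaleC[OF C] scaleC_add_right)
    then show "c *\<^sub>C x + C (c *\<^sub>C N x) = c *\<^sub>C N x"
      by (simp only: N)
  qed
  have "bounded_linear N"
  proof (rule bounded_linear_intro[where K = "1 / (1 - max 0 q)"])
    show "N (x + y) = N x + N y" for x y
    proof (rule uniq)
      have "x + y + C (N x + N y) = (x + C (N x)) + (y + C (N y))"
        by (simp add: bounded_clinear_add[OF C] ac_simps)
      then show "x + y + C (N x + N y) = N x + N y"
        by (simp only: N)
    qed
    show "N (r *\<^sub>R x) = r *\<^sub>R N x" for r x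
      unfolding scaleR_scaleC by (rule scale)
    show "norm (N x) \<le> norm x * (1 / (1 - max 0 q))" for x
    proof -
      have "norm (N x) \<le> norm x + norm (C (N x))"
        using norm_triangle_ineq[of x "C (N x)"] by (simp only: N)
      also have "\<dots> \<le> norm x + max 0 q * norm (N x)"
        using q' by simp
      finally have "norm (N x) * (1 - max 0 q) \<le> norm x"
        by (simp add: algebra_simps)
      with q show ?thesis
        by (simp add: field_simps)
    qed
  qed
  moreover have "N (x - C x) = x" for x
    by (rule uniq) simp
  moreover have "N x - C (N x) = x" for x
    using N[of x] by (simp add: diff_eq_eq)
  ultimately show ?thesis
    unfolding bounded_clinear_def using scale by blast
qed

text \<open>Beyond the operator bound \<open>K\<close> one factors
  \<open>A - z = - z (I - A / z)\<close>, where \<open>A / z\<close> is a strict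
  contraction.\<close>

lemma bounded_spectrum:
  fixes A :: "'a::chilbert_space \<Rightarrow> 'a"
  assumes A: "bounded_clinear A"
  shows "bounded (spectrum A)"
proof -
  obtain K where K: "K > 0" "\<And>x. norm (A x) \<le> norm x * K"
    using A bounded_linear.pos_bounded unfolding bounded_clinear_def by blast
  have "z \<notin> spectrum A" if z: "K < cmod z" for z
  proof -
    have z0: "z \<noteq> 0"
      using z K(1) by auto
    have C: "bounded_clinear (\<lambda>x. inverse z *\<^sub>C A x)"
      by (rule bounded_clinear_scale[OF A])
    have "norm (inverse z *\<^sub>C A x) \<le> (K / cmod z) * norm x" for x
      using K(2)[of x] z0 by (simp add: norm_inverse norm_divide field_simps)
    moreover have "K / cmod z < 1"
      using z K(1) by (simp add: divide_simps)
    ultimately obtain N where N: "bounded_clinear N" "\<And>x. N (x - inverse z *\<^sub>C A x) = x"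
        "\<And>x. N x - inverse z *\<^sub>C A (N x) = x"
      using neumann_inverse[OF C] by metis
    have split: "A x - z *\<^sub>C x = (- z) *\<^sub>C (x - inverse z *\<^sub>C A x)" for x
      using z0 by (simp add: complex_vector.scale_right_diff_distrib scaleC_scaleC scaleC_one)
    define R where "R x = (- inverse z) *\<^sub>C N x" for x
    have "bounded_clinear R"
      unfolding R_def by (rule bounded_clinear_scale[OF N(1)])
    moreover have "R (A x - z *\<^sub>C x) = x" for x
      unfolding split R_def bounded_clinear_scaleC[OF N(1)] N(2)
      using z0 by (simp add: scaleC_scaleC scaleC_one)
    moreover have "A (R x) - z *\<^sub>C R x = x" for x
    proof -
      have "R x - inverse z *\<^sub>C A (R x) = (- inverse z) *\<^sub>C (N x - inverse z *\<^sub>C A (N x))"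
        unfolding R_def bounded_clinear_scaleC[OF A] complex_vector.scale_right_diff_distrib scaleC_scaleC
        by (simp only: mult.commute)
      then have "A (R x) - z *\<^sub>C R x = (- z * - inverse z) *\<^sub>C x"
        unfolding split N(3) by (simp only: scaleC_scaleC)
      then show ?thesis
        using z0 by (simp add: scaleC_one)
    qed
    ultimately show ?thesis
      unfolding spectrum_def by blast
  qed
  then show ?thesis
    unfolding bounded_iff by (meson not_less)
qed

text \<open>The resolvent set is open: with \<open>R\<close> the inverse of \<open>A - z\<close>,
  one has \<open>A - w = (A - z) (I - (w - z) R)\<close>, and the second factor is invertible for
  \<open>w\<close> close to \<open>z\<close>. The inverse of \<open>A - w\<close> is then
  \<open>N\<close> after \<open>R\<close>.\<close>

lemma closed_spectrum:
  fixes A :: "'a::chilbert_space \<Rightarrow> 'a"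
  assumes A: "bounded_clinear A"
  shows "closed (spectrum A)"
  unfolding closed_def open_dist
proof
  fix z assume "z \<in> - spectrum A"
  then obtain R where R: "bounded_clinear R" "\<And>x. R (A x - z *\<^sub>C x) = x"
      "\<And>x. A (R x) - z *\<^sub>C R x = x"
    unfolding spectrum_def by auto
  obtain K where K: "K > 0" "\<And>x. norm (R x) \<le> norm x * K"
    using R(1) bounded_linear.pos_bounded unfolding bounded_clinear_def by blast
  have "w \<notin> spectrum A" if w: "dist w z < 1 / K" for w
  proof -
    have C: "bounded_clinear (\<lambda>x. (w - z) *\<^sub>C R x)"
      by (rule bounded_clinear_scale[OF R(1)])
    have "norm ((w - z) *\<^sub>C R x) \<le> (dist w z * K) * norm x" for x
      using mult_left_mono[OF K(2)[of x], of "cmod (w - z)"] by (simp add: dist_norm ac_simps)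
    moreover have "dist w z * K < 1"
      using w K(1) by (simp add: field_simps)
    ultimately obtain N where N: "bounded_clinear N" "\<And>x. N (x - (w - z) *\<^sub>C R x) = x"
        "\<And>x. N x - (w - z) *\<^sub>C R (N x) = x"
      using neumann_inverse[OF C] by metis
    have split: "A x - w *\<^sub>C x = (A x - z *\<^sub>C x) - (w - z) *\<^sub>C x" for x
      by (simp add: complex_vector.scale_left_diff_distrib)
    have "N (R (A x - w *\<^sub>C x)) = x" for x
      unfolding split bounded_clinear_diff[OF R(1), of "A x - z *\<^sub>C x"]
        bounded_clinear_scaleC[OF R(1)] R(2) N(2) ..
    moreover have "A (N (R x)) - w *\<^sub>C N (R x) = x" for x
    proof -
      \<comment> \<open>Applying \<open>A - z\<close> to the fixed point equation of
        \<open>u\<close> removes both occurrences of \<open>R\<close> and leaves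
        \<open>x + (w - z) u\<close>.\<close>
      define u where "u = N (R x)"
      have u: "u = R x + (w - z) *\<^sub>C R u"
        using N(3)[of "R x"] by (simp add: u_def diff_eq_eq)
      have "A u - z *\<^sub>C u = x + (w - z) *\<^sub>C u"
      proof -
        have "A u - z *\<^sub>C u = (A (R x) - z *\<^sub>C R x) + (w - z) *\<^sub>C (A (R u) - z *\<^sub>C R u)"
          by (subst (1 2) u)
            (simp add: bounded_clinear_add[OF A] bounded_clinear_scaleC[OF A] scaleC_add_right
              complex_vector.scale_right_diff_distrib scaleC_scaleC mult.commute)
        then show ?thesis
          by (simp add: R(3))
      qed
      then show ?thesis
        unfolding split u_def[symmetric] by simp
    qed
    moreover have "bounded_clinear (\<lambda>x. N (R x))"
      by (rule bounded_clinear_comp[OF N(1) R(1)])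
    ultimately show ?thesis
      unfolding spectrum_def by blast
  qed
  then show "\<exists>e>0. \<forall>w. dist w z < e \<longrightarrow> w \<in> - spectrum A"
    using K(1) by (intro exI[of _ "1 / K"]) auto
qed

section \<open>Projection-valued measures\<close>

text \<open>\<open>S\<close> will be the spectrum. Any Borel set that carries \<open>E\<close> will
  do for the integration theory; compactness of \<open>S\<close> is added later, for polynomial
  approximation.\<close>

locale spectral_integration =
  fixes E :: "complex set \<Rightarrow> 'a::chilbert_space \<Rightarrow> 'a" and S :: "complex set"
  assumes pvm: "projection_valued_measure E"
    and S_borel: "S \<in> sets borel"
    and E_S: "E S = id"
begin

abbreviation ssi :: "(complex \<Rightarrow> complex) \<Rightarrow> 'a \<Rightarrow> 'a" where
  "ssi \<equiv> simple_spectral_integral S E"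

abbreviation \<mu> :: "'a \<Rightarrow> complex measure" where
  "\<mu> x \<equiv> scalar_measure_on S E x"

abbreviation BS :: "complex measure" where
  "BS \<equiv> restrict_space borel S"

lemma bounded_clinear_E: "\<Omega> \<in> sets borel \<Longrightarrow> bounded_clinear (E \<Omega>)"
  using pvm by (simp add: projection_valued_measure_def orthogonal_projection_def)

lemma E_idem: "\<Omega> \<in> sets borel \<Longrightarrow> E \<Omega> (E \<Omega> x) = E \<Omega> x"
  using pvm by (simp add: projection_valued_measure_def orthogonal_projection_def fun_eq_iff)

lemma E_selfadjoint: "\<Omega> \<in> sets borel \<Longrightarrow> cinner (E \<Omega> x) y = cinner x (E \<Omega> y)"
  using pvm by (simp add: projection_valued_measure_def orthogonal_projection_def)

lemma E_add: "\<Omega> \<in> sets borel \<Longrightarrow> E \<Omega> (x + y) = E \<Omega> x + E \<Omega> y"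
  by (simp add: bounded_clinear_E bounded_clinear_add)

lemma E_scaleC: "\<Omega> \<in> sets borel \<Longrightarrow> E \<Omega> (c *\<^sub>C x) = c *\<^sub>C E \<Omega> x"
  by (simp add: bounded_clinear_E bounded_clinear_scaleC)

lemma E_sum: "\<Omega> \<in> sets borel \<Longrightarrow> E \<Omega> (sum f I) = (\<Sum>i\<in>I. E \<Omega> (f i))"
  using bounded_clinear_E by (simp add: bounded_clinear_def bounded_linear.linear linear_sum)

lemma E_sums:
  "range F \<subseteq> sets borel \<Longrightarrow> disjoint_family F \<Longrightarrow> (\<lambda>n::nat. E (F n) x) sums E (\<Union>n. F n) x"
  using pvm by (simp add: projection_valued_measure_def)

text \<open>Countable additivity for the constant sequence of empty sets makes a constant series
  converge, so its terms are 0.\<close>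

lemma E_empty [simp]: "E {} x = 0"
proof -
  have "summable (\<lambda>n::nat. E {} x)"
    using E_sums[of "\<lambda>_. {}" x] by (auto simp: disjoint_family_on_def sums_iff)
  from summable_LIMSEQ_zero[OF this] show ?thesis
    by (simp add: LIMSEQ_const_iff)
qed

lemma E_Un:
  assumes "A \<in> sets borel" "B \<in> sets borel" "A \<inter> B = {}"
  shows "E (A \<union> B) x = E A x + E B x"
proof -
  have "(\<lambda>n. E (binaryset A B n) x) sums E (\<Union>n. binaryset A B n) x"
    using assms by (intro E_sums) (auto simp: range_binaryset_eq disjoint_family_on_def binaryset_def)
  moreover have "(\<lambda>n. E (binaryset A B n) x) sums (E A x + E B x)"
    by (rule binaryset_sums) simp
  ultimately show ?thesis
    by (simp add: UN_binaryset_eq sums_unique2)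
qed

lemma E_finite_UN:
  assumes "finite I" "\<And>i. i \<in> I \<Longrightarrow> F i \<in> sets borel" "disjoint_family_on F I"
  shows "E (\<Union>i\<in>I. F i) x = (\<Sum>i\<in>I. E (F i) x)"
  using assms
proof (induction I)
  case (insert i I)
  have "F i \<inter> (\<Union>i\<in>I. F i) = {}"
    using insert.prems(2) insert.hyps(2) by (auto simp: disjoint_family_on_def)
  with insert show ?case
    by (simp add: E_Un disjoint_family_on_mono[OF subset_insertI] sets.finite_UN)
qed simp

lemma power2_norm_E: "\<Omega> \<in> sets borel \<Longrightarrow> (norm (E \<Omega> x))\<^sup>2 = Re (cinner (E \<Omega> x) x)"
  unfolding power2_norm_eq_Re_cinner by (simp add: E_selfadjoint E_idem)

lemma norm_E_le:
  assumes "\<Omega> \<in> sets borel"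
  shows "norm (E \<Omega> x) \<le> norm x"
proof -
  have "(norm (E \<Omega> x))\<^sup>2 \<le> cmod (cinner (E \<Omega> x) x)"
    using assms by (simp add: power2_norm_E complex_Re_le_cmod)
  also have "\<dots> \<le> norm (E \<Omega> x) * norm x"
    by (rule norm_cinner_le)
  finally show ?thesis
    by (cases "E \<Omega> x = 0") (auto simp: power2_eq_square)
qed

text \<open>With \<open>y = E B x\<close> one has \<open>\<parallel>y\<parallel>\<^sup>2 \<ge> \<parallel>E (A \<union> B) y\<parallel>\<^sup>2 = \<parallel>E A y\<parallel>\<^sup>2 + \<parallel>y\<parallel>\<^sup>2\<close>.\<close>

lemma E_disjoint:
  assumes "A \<in> sets borel" "B \<in> sets borel" "A \<inter> B = {}"
  shows "E A (E B x) = 0"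
proof -
  define y where "y = E B x"
  have "(norm (E (A \<union> B) y))\<^sup>2 = Re (cinner (E (A \<union> B) y) y)"
    using assms by (intro power2_norm_E) auto
  also have "\<dots> = (norm (E A y))\<^sup>2 + (norm (E B y))\<^sup>2"
    using assms by (simp add: power2_norm_E E_Un cinner_add_left)
  finally have "(norm (E (A \<union> B) y))\<^sup>2 = (norm (E A y))\<^sup>2 + (norm (E B y))\<^sup>2" .
  moreover have "(norm (E (A \<union> B) y))\<^sup>2 \<le> (norm y)\<^sup>2"
    using assms by (intro power_mono norm_E_le) auto
  moreover have "E B y = y"
    using assms by (simp add: y_def E_idem)
  ultimately show ?thesis
    by (simp add: y_def)
qed

text \<open>Both sets are split along their intersection; the cross terms die by
  \<open>E_disjoint\<close>. This is the source of multiplicativity for all integrals.\<close>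

lemma E_Int:
  assumes "A \<in> sets borel" "B \<in> sets borel"
  shows "E A (E B x) = E (A \<inter> B) x"
proof -
  have B: "E B x = E (A \<inter> B) x + E (B - A) x"
    using assms by (subst E_Un[symmetric]) (auto intro!: arg_cong[where f = "\<lambda>\<Omega>. E \<Omega> x"])
  have A: "E A y = E (A \<inter> B) y + E (A - B) y" for y
    using assms by (subst E_Un[symmetric]) (auto intro!: arg_cong[where f = "\<lambda>\<Omega>. E \<Omega> y"])
  have "E A (E B x) = E A (E (A \<inter> B) x)"
    unfolding B using assms by (simp add: E_add E_disjoint Int_Diff)
  also have "\<dots> = E (A \<inter> B) x"
    using assms by (subst A) (auto simp: E_idem intro!: E_disjoint)
  finally show ?thesis .
qed

section \<open>The scalar measures\<close>

lemma sets_scalar_measure [simp]: "sets (scalar_measure E x) = sets borel"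
  using sets.sigma_sets_eq[of "borel :: complex measure"] by (simp add: scalar_measure_def)

lemma space_scalar_measure [simp]: "space (scalar_measure E x) = UNIV"
  by (simp add: scalar_measure_def space_measure_of_conv)

text \<open>\<open>measure_of\<close> yields the intended values only once countable additivity is
  known. It follows by applying the bounded functional \<open>\<lambda>y. Re (cinner y x)\<close> to
  the strongly convergent series of projections.\<close>

lemma emeasure_scalar_measure:
  assumes "\<Omega> \<in> sets borel"
  shows "emeasure (scalar_measure E x) \<Omega> = ennreal ((norm (E \<Omega> x))\<^sup>2)"
proof -
  have "emeasure (scalar_measure E x) \<Omega> = ennreal (Re (cinner (E \<Omega> x) x))"
  proof (rule emeasure_measure_of[OF scalar_measure_def])
    show "countably_additive (sets (scalar_measure E x)) (\<lambda>\<Omega>. ennreal (Re (cinner (E \<Omega> x) x)))"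
    proof (rule countably_additiveI)
      fix F :: "nat \<Rightarrow> complex set"
      assume F: "range F \<subseteq> sets (scalar_measure E x)" "disjoint_family F"
        "\<Union> (range F) \<in> sets (scalar_measure E x)"
      then have Fb: "F n \<in> sets borel" for n
        by auto
      have "bounded_linear (\<lambda>y. Re (cinner y x))"
        by (rule bounded_linear_compose[OF bounded_linear_Re
            bounded_bilinear.bounded_linear_left[OF bounded_bilinear_cinner]])
      from bounded_linear.sums[OF this E_sums[of F x]]
      have "(\<lambda>n. Re (cinner (E (F n) x) x)) sums Re (cinner (E (\<Union>n. F n) x) x)"
        using F by simp
      then show "(\<Sum>n. ennreal (Re (cinner (E (F n) x) x)))
          = ennreal (Re (cinner (E (\<Union> (range F)) x) x))"
        using Fb by (intro suminf_ennreal_eq) (simp_all flip: power2_norm_E)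
    qed
  qed (use assms in \<open>auto simp: positive_def\<close>)
  with assms show ?thesis
    by (simp add: power2_norm_E)
qed

lemma space_\<mu> [simp]: "space (\<mu> x) = S"
  by (simp add: space_restrict_space)

lemma sets_\<mu> [measurable_cong]: "sets (\<mu> x) = sets BS"
  by (rule sets_restrict_space_cong) simp

lemma sets_BS_iff: "\<Omega> \<in> sets BS \<longleftrightarrow> \<Omega> \<subseteq> S \<and> \<Omega> \<in> sets borel"
  using S_borel by (simp add: sets_restrict_space_iff)

lemma measurable_\<mu>: "f \<in> measurable (\<mu> x) K \<longleftrightarrow> f \<in> measurable BS K"
  by (simp cong: measurable_cong_sets add: measurable_cong_sets[OF sets_\<mu> refl])

lemma emeasure_\<mu>:
  "\<Omega> \<in> sets borel \<Longrightarrow> \<Omega> \<subseteq> S \<Longrightarrow> emeasure (\<mu> x) \<Omega> = ennreal ((norm (E \<Omega> x))\<^sup>2)"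
  using S_borel by (simp add: emeasure_restrict_space emeasure_scalar_measure)

lemma emeasure_\<mu>_space: "emeasure (\<mu> x) S = ennreal ((norm x)\<^sup>2)"
  using emeasure_\<mu>[OF S_borel subset_refl] by (simp add: E_S)


section \<open>Integrals of simple functions\<close>

lemma simple_BS:
  assumes "simple_function BS s"
  shows "finite (s ` S)" "s -` {c} \<inter> S \<in> sets borel"
  using simple_functionD[OF assms] sets_BS_iff by (auto simp: space_restrict_space)

lemma disjoint_family_vimage: "disjoint_family_on (\<lambda>d. p -` {d} \<inter> S) D"
  by (auto simp: disjoint_family_on_def)

text \<open>A level set of \<phi> composed with \<open>p\<close> is the disjoint union of level sets
  of \<open>p\<close>. Values in \<open>D\<close> that \<open>p\<close> does not attain have empty
  level sets and contribute 0; this slack, and the free codomain of \<open>p\<close>, allow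
  \<open>p\<close> to be a pair of functions below.\<close>

lemma ssi_compose:
  assumes p: "simple_function BS p" and D: "finite D" "p ` S \<subseteq> D"
  shows "ssi (\<lambda>z. \<phi> (p z)) x = (\<Sum>d\<in>D. \<phi> d *\<^sub>C E (p -` {d} \<inter> S) x)"
proof -
  have "ssi (\<lambda>z. \<phi> (p z)) x = (\<Sum>c\<in>\<phi> ` p ` S. c *\<^sub>C E ((\<lambda>z. \<phi> (p z)) -` {c} \<inter> S) x)"
    by (simp add: simple_spectral_integral_def image_image)
  also have "\<dots> = (\<Sum>c\<in>\<phi> ` p ` S. \<Sum>d\<in>{d \<in> p ` S. \<phi> d = c}. \<phi> d *\<^sub>C E (p -` {d} \<inter> S) x)"
  proof (rule sum.cong[OF refl])
    fix c assume "c \<in> \<phi> ` p ` S"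
    have "E ((\<lambda>z. \<phi> (p z)) -` {c} \<inter> S) x = E (\<Union>d\<in>{d \<in> p ` S. \<phi> d = c}. p -` {d} \<inter> S) x"
      by (rule arg_cong[where f = "\<lambda>A. E A x"]) auto
    also have "\<dots> = (\<Sum>d\<in>{d \<in> p ` S. \<phi> d = c}. E (p -` {d} \<inter> S) x)"
      using simple_BS[OF p] by (intro E_finite_UN disjoint_family_vimage) auto
    finally show "c *\<^sub>C E ((\<lambda>z. \<phi> (p z)) -` {c} \<inter> S) x
        = (\<Sum>d\<in>{d \<in> p ` S. \<phi> d = c}. \<phi> d *\<^sub>C E (p -` {d} \<inter> S) x)"
      by (simp add: complex_vector.scale_sum_right)
  qed
  also have "\<dots> = (\<Sum>d\<in>p ` S. \<phi> d *\<^sub>C E (p -` {d} \<inter> S) x)"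
    using simple_BS(1)[OF p] by (rule sum.image_gen[symmetric])
  also have "\<dots> = (\<Sum>d\<in>D. \<phi> d *\<^sub>C E (p -` {d} \<inter> S) x)"
  proof (rule sum.mono_neutral_left[OF D])
    show "\<forall>d\<in>D - p ` S. \<phi> d *\<^sub>C E (p -` {d} \<inter> S) x = 0"
    proof
      fix d assume "d \<in> D - p ` S"
      then have "p -` {d} \<inter> S = {}"
        by auto
      then show "\<phi> d *\<^sub>C E (p -` {d} \<inter> S) x = 0"
        by simp
    qed
  qed
  finally show ?thesis .
qed

text \<open>Passing to the common refinement of the level sets once serves sums, differences and
  products alike.\<close>

lemma ssi_compose2:
  assumes s: "simple_function BS s" and t: "simple_function BS t"
  shows "ssi (\<lambda>z. \<phi> (s z) (t z)) x
    = (\<Sum>c\<in>s ` S. \<Sum>d\<in>t ` S. \<phi> c d *\<^sub>C E (s -` {c} \<inter> (t -` {d} \<inter> S)) x)"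
proof -
  have "(\<lambda>z. (s z, t z)) -` {d} \<inter> S = s -` {fst d} \<inter> (t -` {snd d} \<inter> S)" for d
    by auto
  moreover have "(\<lambda>z. (s z, t z)) ` S \<subseteq> s ` S \<times> t ` S"
    by auto
  ultimately show ?thesis
    using ssi_compose[OF simple_function_Pair[OF s t], of "s ` S \<times> t ` S" "\<lambda>d. \<phi> (fst d) (snd d)" x]
      simple_BS(1)[OF s] simple_BS(1)[OF t]
    by (simp add: sum.cartesian_product case_prod_beta)
qed

lemma ssi_add:
  assumes "simple_function BS s" "simple_function BS t"
  shows "ssi (\<lambda>z. s z + t z) x = ssi s x + ssi t x"
  using ssi_compose2[OF assms, of "(+)" x] ssi_compose2[OF assms, of "\<lambda>c d. c" x]
    ssi_compose2[OF assms, of "\<lambda>c d. d" x]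
  by (simp add: scaleC_add_left sum.distrib)

lemma ssi_diff:
  assumes "simple_function BS s" "simple_function BS t"
  shows "ssi (\<lambda>z. s z - t z) x = ssi s x - ssi t x"
  using ssi_compose2[OF assms, of "(-)" x] ssi_compose2[OF assms, of "\<lambda>c d. c" x]
    ssi_compose2[OF assms, of "\<lambda>c d. d" x]
  by (simp add: complex_vector.scale_left_diff_distrib sum_subtractf)

lemma ssi_scaleC:
  assumes "simple_function BS s"
  shows "ssi (\<lambda>z. c * s z) x = c *\<^sub>C ssi s x"
  using ssi_compose[OF assms simple_BS(1)[OF assms] subset_refl, of "\<lambda>w. c * w" x]
  by (simp add: simple_spectral_integral_def complex_vector.scale_sum_right scaleC_scaleC)

text \<open>On the common refinement the product of two projections is the projection of the
  intersection, by \<open>E_Int\<close>.\<close>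

lemma ssi_mult:
  assumes s: "simple_function BS s" and t: "simple_function BS t"
  shows "ssi (\<lambda>z. s z * t z) x = ssi s (ssi t x)"
proof -
  have "E (s -` {c} \<inter> S) (E (t -` {d} \<inter> S) x) = E (s -` {c} \<inter> (t -` {d} \<inter> S)) x" for c d
    using simple_BS(2)[OF s] simple_BS(2)[OF t] by (simp add: E_Int Int_ac)
  then show ?thesis
    unfolding ssi_compose2[OF s t]
    using simple_BS(2)[OF s]
    by (simp add: simple_spectral_integral_def E_sum E_scaleC scaleC_scaleC
        complex_vector.scale_sum_right)
qed

lemma ssi_adjoint:
  assumes s: "simple_function BS s"
  shows "cinner (ssi (\<lambda>z. cnj (s z)) x) y = cinner x (ssi s y)"
  using ssi_compose[OF s simple_BS(1)[OF s] subset_refl, of cnj x] simple_BS(2)[OF s]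
  by (simp add: simple_spectral_integral_def cinner_sum_left cinner_sum_right cinner_scaleC_left
      cinner_scaleC_right E_selfadjoint)

lemma bounded_clinear_ssi:
  assumes s: "simple_function BS s"
  shows "bounded_clinear (ssi s)"
proof -
  have "bounded_linear (\<lambda>x. c *\<^sub>C E (s -` {c} \<inter> S) x)" for c
    using bounded_clinear_scale[OF bounded_clinear_E[OF simple_BS(2)[OF s]]]
    by (simp add: bounded_clinear_def)
  then have "bounded_linear (ssi s)"
    unfolding simple_spectral_integral_def by (intro bounded_linear_sum)
  then show ?thesis
    using simple_BS(2)[OF s]
    by (simp add: bounded_clinear_def simple_spectral_integral_def E_scaleC scaleC_scaleC
        complex_vector.scale_sum_right mult.commute)
qed

text \<open>Pythagoras: different level sets are disjoint, so the summands are pairwise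
  orthogonal.\<close>

lemma power2_norm_ssi:
  assumes s: "simple_function BS s"
  shows "(norm (ssi s x))\<^sup>2 = (\<Sum>c\<in>s ` S. (cmod c)\<^sup>2 * (norm (E (s -` {c} \<inter> S) x))\<^sup>2)"
proof -
  define y where "y c = c *\<^sub>C E (s -` {c} \<inter> S) x" for c
  have orth: "cinner (y c) (y d) = 0" if "c \<noteq> d" for c d
  proof -
    have "E (s -` {c} \<inter> S) (E (s -` {d} \<inter> S) x) = 0"
      using that simple_BS(2)[OF s] by (intro E_disjoint) auto
    then show ?thesis
      using simple_BS(2)[OF s]
      by (simp add: y_def cinner_scaleC_left cinner_scaleC_right E_selfadjoint)
  qed
  have "cinner (ssi s x) (ssi s x) = (\<Sum>c\<in>s ` S. \<Sum>d\<in>s ` S. cinner (y c) (y d))"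
    by (simp add: simple_spectral_integral_def y_def cinner_sum_left cinner_sum_right)
       (rule sum.swap)
  also have "\<dots> = (\<Sum>c\<in>s ` S. \<Sum>d\<in>s ` S. if c = d then cinner (y c) (y c) else 0)"
    using orth by (intro sum.cong) auto
  also have "\<dots> = (\<Sum>c\<in>s ` S. cinner (y c) (y c))"
    using simple_BS(1)[OF s] by simp
  finally have "(norm (ssi s x))\<^sup>2 = (\<Sum>c\<in>s ` S. (norm (y c))\<^sup>2)"
    by (simp add: power2_norm_eq_Re_cinner)
  then show ?thesis
    by (simp add: y_def power_mult_distrib)
qed

lemma ssi_isometry:
  assumes s: "simple_function BS s"
  shows "ennreal ((norm (ssi s x))\<^sup>2) = (\<integral>\<^sup>+z. ennreal ((cmod (s z))\<^sup>2) \<partial>\<mu> x)"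
proof -
  have "(\<integral>\<^sup>+z. ennreal ((cmod (s z))\<^sup>2) \<partial>\<mu> x)
      = (\<integral>\<^sup>+z. (\<Sum>c\<in>s ` S. ennreal ((cmod c)\<^sup>2) * indicator (s -` {c} \<inter> S) z) \<partial>\<mu> x)"
  proof (rule nn_integral_cong)
    fix z assume "z \<in> space (\<mu> x)"
    then have z: "z \<in> S"
      by simp
    have "(\<Sum>c\<in>s ` S. ennreal ((cmod c)\<^sup>2) * indicator (s -` {c} \<inter> S) z)
        = (\<Sum>c\<in>s ` S. if c = s z then ennreal ((cmod (s z))\<^sup>2) else 0)"
      using z by (intro sum.cong) (auto simp: indicator_def)
    also have "\<dots> = ennreal ((cmod (s z))\<^sup>2)"
      using z simple_BS(1)[OF s] by simp
    finally show "ennreal ((cmod (s z))\<^sup>2)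
        = (\<Sum>c\<in>s ` S. ennreal ((cmod c)\<^sup>2) * indicator (s -` {c} \<inter> S) z)" ..
  qed
  also have "\<dots> = (\<Sum>c\<in>s ` S. ennreal ((cmod c)\<^sup>2) * emeasure (\<mu> x) (s -` {c} \<inter> S))"
    using simple_BS(2)[OF s]
    by (subst nn_integral_sum)
      (auto intro!: sum.cong nn_integral_cmult_indicator borel_measurable_times_ennreal
        borel_measurable_indicator simp: sets_\<mu> sets_BS_iff)
  also have "\<dots> = ennreal ((norm (ssi s x))\<^sup>2)"
    using simple_BS(2)[OF s]
    by (simp add: power2_norm_ssi[OF s] emeasure_\<mu> ennreal_mult'' sum_ennreal[symmetric]
        del: sum_ennreal)
  finally show ?thesis ..
qed

end

section \<open>Integrals of square-integrable functions\<close>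

lemma tendsto_0_iff_ennreal_power2_norm:
  fixes u :: "nat \<Rightarrow> 'b::real_normed_vector"
  shows "(\<lambda>n. ennreal ((norm (u n))\<^sup>2)) \<longlonglongrightarrow> 0 \<longleftrightarrow> u \<longlonglongrightarrow> 0"
proof -
  have "(\<lambda>n. ennreal ((norm (u n))\<^sup>2)) \<longlonglongrightarrow> 0 \<longleftrightarrow> (\<lambda>n. (norm (u n))\<^sup>2) \<longlonglongrightarrow> 0"
    using tendsto_ennreal_iff[of "\<lambda>n. (norm (u n))\<^sup>2" sequentially 0] by simp
  also have "\<dots> \<longleftrightarrow> (\<lambda>n. norm (u n)) \<longlonglongrightarrow> 0"
  proof
    assume "(\<lambda>n. (norm (u n))\<^sup>2) \<longlonglongrightarrow> 0"
    from tendsto_real_sqrt[OF this] show "(\<lambda>n. norm (u n)) \<longlonglongrightarrow> 0"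
      by simp
  next
    assume "(\<lambda>n. norm (u n)) \<longlonglongrightarrow> 0"
    from tendsto_power[OF this, of 2] show "(\<lambda>n. (norm (u n))\<^sup>2) \<longlonglongrightarrow> 0"
      by simp
  qed
  finally show ?thesis
    by (simp add: tendsto_norm_zero_iff)
qed

text \<open>A substitute for the triangle inequality that keeps to squares, so that no roots of
  \<open>ennreal\<close> integrals are needed. The factor 2 is harmless for finiteness and for
  convergence to 0.\<close>

lemma power2_norm_add_le:
  fixes x y :: "'b::real_normed_vector"
  shows "(norm (x + y))\<^sup>2 \<le> 2 * (norm x)\<^sup>2 + 2 * (norm y)\<^sup>2"
proof -
  have "(norm (x + y))\<^sup>2 \<le> (norm x + norm y)\<^sup>2"
    by (intro power_mono norm_triangle_ineq) simp
  also have "\<dots> \<le> 2 * (norm x)\<^sup>2 + 2 * (norm y)\<^sup>2"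
    using zero_le_power2[of "norm x - norm y"] by (simp add: power2_eq_square algebra_simps)
  finally show ?thesis .
qed

lemma nn_integral_power2_norm_add_le:
  fixes f h :: "'b \<Rightarrow> complex"
  assumes [measurable]: "f \<in> borel_measurable M" "h \<in> borel_measurable M"
  shows "(\<integral>\<^sup>+z. ennreal ((cmod (f z + h z))\<^sup>2) \<partial>M)
    \<le> 2 * (\<integral>\<^sup>+z. ennreal ((cmod (f z))\<^sup>2) \<partial>M) + 2 * (\<integral>\<^sup>+z. ennreal ((cmod (h z))\<^sup>2) \<partial>M)"
proof -
  have "(\<integral>\<^sup>+z. ennreal ((cmod (f z + h z))\<^sup>2) \<partial>M)
      \<le> (\<integral>\<^sup>+z. 2 * ennreal ((cmod (f z))\<^sup>2) + 2 * ennreal ((cmod (h z))\<^sup>2) \<partial>M)"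
  proof (rule nn_integral_mono)
    fix z
    have "ennreal ((cmod (f z + h z))\<^sup>2) \<le> ennreal (2 * (cmod (f z))\<^sup>2 + 2 * (cmod (h z))\<^sup>2)"
      by (intro ennreal_leI power2_norm_add_le)
    then show "ennreal ((cmod (f z + h z))\<^sup>2)
        \<le> 2 * ennreal ((cmod (f z))\<^sup>2) + 2 * ennreal ((cmod (h z))\<^sup>2)"
      by (simp add: ennreal_mult)
  qed
  also have "\<dots> = 2 * (\<integral>\<^sup>+z. ennreal ((cmod (f z))\<^sup>2) \<partial>M) + 2 * (\<integral>\<^sup>+z. ennreal ((cmod (h z))\<^sup>2) \<partial>M)"
    by (simp add: nn_integral_add nn_integral_cmult)
  finally show ?thesis .
qed

context spectral_integration
begin

abbreviation hsi :: "(complex \<Rightarrow> complex) \<Rightarrow> 'a \<Rightarrow> 'a \<Rightarrow> bool" where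
  "hsi \<equiv> has_spectral_integral S E"

text \<open>The squared \<open>L\<^sup>2\<close> distance, valued in \<open>ennreal\<close> so that
  it makes sense before square integrability is known.\<close>

definition dist2 :: "'a \<Rightarrow> (complex \<Rightarrow> complex) \<Rightarrow> (complex \<Rightarrow> complex) \<Rightarrow> ennreal" where
  "dist2 x f h = (\<integral>\<^sup>+z. ennreal ((cmod (f z - h z))\<^sup>2) \<partial>\<mu> x)"

lemma dist2_commute: "dist2 x f h = dist2 x h f"
  by (simp add: dist2_def norm_minus_commute)

lemma dist2_triangle:
  assumes [measurable]: "f \<in> borel_measurable BS" "h \<in> borel_measurable BS" "k \<in> borel_measurable BS"
  shows "dist2 x f k \<le> 2 * dist2 x f h + 2 * dist2 x h k"
  using nn_integral_power2_norm_add_le[of "\<lambda>z. f z - h z" "\<mu> x" "\<lambda>z. h z - k z"]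
  by (simp add: dist2_def)

lemma dist2_tendsto_0_triangle:
  assumes meas: "\<And>n. f n \<in> borel_measurable BS" "h \<in> borel_measurable BS" "\<And>n. k n \<in> borel_measurable BS"
    and f: "(\<lambda>n. dist2 x (f n) h) \<longlonglongrightarrow> 0" and k: "(\<lambda>n. dist2 x h (k n)) \<longlonglongrightarrow> 0"
  shows "(\<lambda>n. dist2 x (f n) (k n)) \<longlonglongrightarrow> 0"
proof (rule tendsto_sandwich[where f = "\<lambda>_. 0"])
  show "\<forall>\<^sub>F n in sequentially. dist2 x (f n) (k n) \<le> 2 * dist2 x (f n) h + 2 * dist2 x h (k n)"
    using meas by (intro always_eventually allI dist2_triangle)
  have "(\<lambda>n. 2 * dist2 x (f n) h + 2 * dist2 x h (k n)) \<longlonglongrightarrow> 2 * 0 + 2 * 0"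
    using f k by (intro tendsto_add ennreal_tendsto_cmult) auto
  then show "(\<lambda>n. 2 * dist2 x (f n) h + 2 * dist2 x h (k n)) \<longlonglongrightarrow> 0"
    by simp
qed auto

lemma dist2_tendsto_dominated:
  assumes [measurable]: "f \<in> borel_measurable BS" "\<And>n. u n \<in> borel_measurable BS"
      "w \<in> borel_measurable BS"
    and lim: "\<And>z. z \<in> S \<Longrightarrow> (\<lambda>n. u n z) \<longlonglongrightarrow> f z"
    and bd: "\<And>n z. z \<in> S \<Longrightarrow> cmod (u n z) \<le> w z"
    and fin: "(\<integral>\<^sup>+z. ennreal ((w z)\<^sup>2) \<partial>\<mu> x) < \<infinity>"
  shows "(\<lambda>n. dist2 x f (u n)) \<longlonglongrightarrow> 0"
proof -
  have f_le: "cmod (f z) \<le> w z" if "z \<in> S" for z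
    using tendsto_norm[OF lim[OF that]] bd[OF that] by (intro LIMSEQ_le_const2) auto
  have "(\<lambda>n. dist2 x f (u n)) \<longlonglongrightarrow> (\<integral>\<^sup>+z. 0 \<partial>\<mu> x)"
    unfolding dist2_def
  proof (rule nn_integral_dominated_convergence)
    \<comment> \<open>Both \<open>f\<close> and \<open>u n\<close> are bounded by \<open>w\<close>,
      so the difference is at most \<open>2 * w\<close> and its square at most 4 times that of
      \<open>w\<close>.\<close>
    show "(\<integral>\<^sup>+z. 4 * ennreal ((w z)\<^sup>2) \<partial>\<mu> x) < \<infinity>"
      using fin by (simp add: nn_integral_cmult ennreal_mult_less_top)
    show "AE z in \<mu> x. ennreal ((cmod (f z - u n z))\<^sup>2) \<le> 4 * ennreal ((w z)\<^sup>2)" for n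
    proof (rule AE_I2)
      fix z assume "z \<in> space (\<mu> x)"
      then have z: "z \<in> S"
        by simp
      have "cmod (f z - u n z) \<le> 2 * w z"
        using norm_triangle_ineq4[of "f z" "u n z"] f_le[OF z] bd[OF z, of n] by linarith
      then have "(cmod (f z - u n z))\<^sup>2 \<le> (2 * w z)\<^sup>2"
        by (intro power_mono) auto
      then have "ennreal ((cmod (f z - u n z))\<^sup>2) \<le> ennreal (4 * (w z)\<^sup>2)"
        by (intro ennreal_leI) (simp add: power_mult_distrib)
      then show "ennreal ((cmod (f z - u n z))\<^sup>2) \<le> 4 * ennreal ((w z)\<^sup>2)"
        by (simp add: ennreal_mult)
    qed
    show "AE z in \<mu> x. (\<lambda>n. ennreal ((cmod (f z - u n z))\<^sup>2)) \<longlonglongrightarrow> 0"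
    proof (rule AE_I2)
      fix z assume "z \<in> space (\<mu> x)"
      then have "(\<lambda>n. f z - u n z) \<longlonglongrightarrow> f z - f z"
        by (intro tendsto_diff tendsto_const lim) simp
      then show "(\<lambda>n. ennreal ((cmod (f z - u n z))\<^sup>2)) \<longlonglongrightarrow> 0"
        unfolding tendsto_0_iff_ennreal_power2_norm by simp
    qed
  qed measurable
  then show ?thesis
    by simp
qed

lemma simple_measurable: "simple_function BS s \<Longrightarrow> s \<in> borel_measurable BS"
  by (rule borel_measurable_simple_function)

lemma ex_simple_approx:
  fixes f :: "complex \<Rightarrow> complex"
  assumes "f \<in> borel_measurable BS"
  obtains s where "\<And>n. simple_function BS (s n)" "\<And>z. z \<in> S \<Longrightarrow> (\<lambda>n. s n z) \<longlonglongrightarrow> f z"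
    "\<And>n z. z \<in> S \<Longrightarrow> cmod (s n z) \<le> 2 * cmod (f z)"
  using borel_measurable_implies_sequence_metric[OF assms, of 0] that
  unfolding space_restrict_space dist_0_norm norm_conv_dist[symmetric] by (metis IntI UNIV_I space_borel)

lemma ssi_dist2:
  assumes "simple_function BS s" "simple_function BS t"
  shows "ennreal ((norm (ssi s x - ssi t x))\<^sup>2) = dist2 x s t"
  using ssi_isometry[OF simple_function_diff[OF assms], of x]
  by (simp add: dist2_def ssi_diff[OF assms])

section \<open>The integral as a relation: uniqueness, existence, isometry, linearity\<close>

lemma hsi_def:
  "hsi f x y \<longleftrightarrow> f \<in> borel_measurable BS \<and> (\<exists>s. (\<forall>n. simple_function BS (s n)) \<and>
     (\<lambda>n. dist2 x f (s n)) \<longlonglongrightarrow> 0 \<and> (\<lambda>n. ssi (s n) x) \<longlonglongrightarrow> y)"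
  by (simp add: has_spectral_integral_def dist2_def)

lemma hsi_measurable: "hsi f x y \<Longrightarrow> f \<in> borel_measurable BS"
  by (simp add: hsi_def)

text \<open>Two approximations of the same \<open>f\<close> approach each other in
  \<open>L\<^sup>2\<close>, and by the isometry for simple functions so do their integrals. Hence
  any convenient sequence may replace the one in the definition.\<close>

lemma hsi_ssi_tendsto:
  assumes hsi: "hsi f x y" and t: "\<And>n. simple_function BS (t n)" "(\<lambda>n. dist2 x f (t n)) \<longlonglongrightarrow> 0"
  shows "(\<lambda>n. ssi (t n) x) \<longlonglongrightarrow> y"
proof -
  obtain s where s: "\<And>n. simple_function BS (s n)" "(\<lambda>n. dist2 x f (s n)) \<longlonglongrightarrow> 0"
      "(\<lambda>n. ssi (s n) x) \<longlonglongrightarrow> y"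
    using hsi unfolding hsi_def by blast
  have "(\<lambda>n. dist2 x (t n) (s n)) \<longlonglongrightarrow> 0"
    using t(2) unfolding dist2_commute[of x f]
    by (rule dist2_tendsto_0_triangle[OF simple_measurable[OF t(1)] hsi_measurable[OF hsi]
          simple_measurable[OF s(1)] _ s(2)])
  then have "(\<lambda>n. ssi (t n) x - ssi (s n) x) \<longlonglongrightarrow> 0"
    by (simp add: ssi_dist2[OF t(1) s(1), symmetric] tendsto_0_iff_ennreal_power2_norm)
  from tendsto_add[OF this s(3)] show ?thesis
    by simp
qed

lemma hsi_unique:
  assumes "hsi f x y" "hsi f x y'"
  shows "y = y'"
proof -
  obtain s where s: "\<And>n. simple_function BS (s n)" "(\<lambda>n. dist2 x f (s n)) \<longlonglongrightarrow> 0"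
    using assms(1) unfolding hsi_def by blast
  show ?thesis
    by (rule LIMSEQ_unique[OF hsi_ssi_tendsto[OF assms(1) s] hsi_ssi_tendsto[OF assms(2) s]])
qed

lemma hsi_simple: "simple_function BS s \<Longrightarrow> hsi s x (ssi s x)"
  unfolding hsi_def by (intro conjI simple_measurable exI[of _ "\<lambda>_. s"]) (simp_all add: dist2_def)

lemma hsi_exists:
  assumes f: "f \<in> borel_measurable BS" and fin: "(\<integral>\<^sup>+z. ennreal ((cmod (f z))\<^sup>2) \<partial>\<mu> x) < \<infinity>"
  shows "\<exists>y. hsi f x y"
proof -
  note [measurable] = f
  obtain s where s: "\<And>n. simple_function BS (s n)" "\<And>z. z \<in> S \<Longrightarrow> (\<lambda>n. s n z) \<longlonglongrightarrow> f z"
    "\<And>n z. z \<in> S \<Longrightarrow> cmod (s n z) \<le> 2 * cmod (f z)"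
    using ex_simple_approx[OF f] by metis
  have "(\<integral>\<^sup>+z. ennreal ((2 * cmod (f z))\<^sup>2) \<partial>\<mu> x) = 4 * (\<integral>\<^sup>+z. ennreal ((cmod (f z))\<^sup>2) \<partial>\<mu> x)"
    by (simp add: power_mult_distrib ennreal_mult nn_integral_cmult)
  with fin have lim: "(\<lambda>n. dist2 x f (s n)) \<longlonglongrightarrow> 0"
    by (intro dist2_tendsto_dominated[where w = "\<lambda>z. 2 * cmod (f z)"] s simple_measurable[OF s(1)] f)
      (auto simp: ennreal_mult_less_top)
  have "Cauchy (\<lambda>n. ssi (s n) x)"
  proof (rule CauchyI)
    fix e :: real assume "e > 0"
    \<comment> \<open>Two distances below \<open>e\<^sup>2 / 8\<close>, each with the factor 2 of
      \<open>dist2_triangle\<close>, add up to \<open>e\<^sup>2 / 2\<close>.\<close>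
    then have "0 < ennreal (e\<^sup>2 / 8)"
      by simp
    then obtain N where N: "\<And>n. n \<ge> N \<Longrightarrow> dist2 x f (s n) < ennreal (e\<^sup>2 / 8)"
      using order_tendstoD(2)[OF lim] unfolding eventually_sequentially by blast
    show "\<exists>N. \<forall>m\<ge>N. \<forall>n\<ge>N. norm (ssi (s m) x - ssi (s n) x) < e"
    proof (intro exI allI impI)
      fix m n assume "m \<ge> N" "n \<ge> N"
      have "ennreal ((norm (ssi (s m) x - ssi (s n) x))\<^sup>2) \<le> 2 * dist2 x (s m) f + 2 * dist2 x f (s n)"
        unfolding ssi_dist2[OF s(1) s(1)] by (intro dist2_triangle simple_measurable[OF s(1)] f)
      also have "\<dots> \<le> 2 * ennreal (e\<^sup>2 / 8) + 2 * ennreal (e\<^sup>2 / 8)"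
        using N[OF \<open>m \<ge> N\<close>] N[OF \<open>n \<ge> N\<close>] unfolding dist2_commute[of x "s m"]
        by (intro add_mono mult_left_mono) auto
      also have "\<dots> = ennreal (e\<^sup>2 / 2)"
        using ennreal_mult[of 2 "e\<^sup>2 / 8"] ennreal_plus[of "e\<^sup>2 / 4" "e\<^sup>2 / 4"]
        by (simp del: ennreal_plus)
      finally have "(norm (ssi (s m) x - ssi (s n) x))\<^sup>2 \<le> e\<^sup>2 / 2"
        by (simp add: ennreal_le_iff)
      also have "\<dots> < e\<^sup>2"
        using \<open>e > 0\<close> by simp
      finally have "(norm (ssi (s m) x - ssi (s n) x))\<^sup>2 < e\<^sup>2" .
      then show "norm (ssi (s m) x - ssi (s n) x) < e"
        using \<open>e > 0\<close> by (simp add: power_less_imp_less_base)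
    qed
  qed
  then obtain y where "(\<lambda>n. ssi (s n) x) \<longlonglongrightarrow> y"
    using Cauchy_convergent convergent_def by blast
  with f s lim show ?thesis
    unfolding hsi_def by blast
qed

text \<open>Some simple function has finite distance from \<open>f\<close>, and simple functions are
  square integrable. Together with \<open>hsi_exists\<close> this identifies the integrable
  functions with those in \<open>L\<^sup>2\<close>.\<close>

lemma hsi_finite:
  assumes hsi: "hsi f x y"
  shows "(\<integral>\<^sup>+z. ennreal ((cmod (f z))\<^sup>2) \<partial>\<mu> x) < \<infinity>"
proof -
  obtain s where s: "\<And>n. simple_function BS (s n)" "(\<lambda>n. dist2 x f (s n)) \<longlonglongrightarrow> 0"
    using hsi unfolding hsi_def by blast
  then obtain n where n: "dist2 x f (s n) < 1"
    using order_tendstoD(2)[OF s(2), of 1] unfolding eventually_sequentially by force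
  have "(\<integral>\<^sup>+z. ennreal ((cmod (f z))\<^sup>2) \<partial>\<mu> x) = dist2 x f (\<lambda>_. 0)"
    by (simp add: dist2_def)
  also have "\<dots> \<le> 2 * dist2 x f (s n) + 2 * dist2 x (s n) (\<lambda>_. 0)"
    using hsi_measurable[OF hsi] simple_measurable[OF s(1)] by (intro dist2_triangle) auto
  also have "\<dots> < \<infinity>"
    using order.strict_trans[OF n ennreal_one_less_top] ssi_isometry[OF s(1), of n x, symmetric]
    by (simp add: dist2_def ennreal_mult_less_top)
  finally show ?thesis .
qed

text \<open>The sequence from the definition converges only in \<open>L\<^sup>2\<close>; a pointwise
  convergent and dominated one is used instead, so that the integrals of the squares converge as
  well.\<close>

lemma hsi_isometry:
  assumes hsi: "hsi f x y"
  shows "ennreal ((norm y)\<^sup>2) = (\<integral>\<^sup>+z. ennreal ((cmod (f z))\<^sup>2) \<partial>\<mu> x)"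
proof -
  note f [measurable] = hsi_measurable[OF hsi]
  obtain s where s: "\<And>n. simple_function BS (s n)" "\<And>z. z \<in> S \<Longrightarrow> (\<lambda>n. s n z) \<longlonglongrightarrow> f z"
    "\<And>n z. z \<in> S \<Longrightarrow> cmod (s n z) \<le> 2 * cmod (f z)"
    using ex_simple_approx[OF f] by metis
  note [measurable] = simple_measurable[OF s(1)]
  have "(\<integral>\<^sup>+z. ennreal ((2 * cmod (f z))\<^sup>2) \<partial>\<mu> x) = 4 * (\<integral>\<^sup>+z. ennreal ((cmod (f z))\<^sup>2) \<partial>\<mu> x)"
    by (simp add: power_mult_distrib ennreal_mult nn_integral_cmult)
  then have fin: "(\<integral>\<^sup>+z. ennreal ((2 * cmod (f z))\<^sup>2) \<partial>\<mu> x) < \<infinity>"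
    using hsi_finite[OF hsi] by (simp add: ennreal_mult_less_top)
  then have lim: "(\<lambda>n. dist2 x f (s n)) \<longlonglongrightarrow> 0"
    by (intro dist2_tendsto_dominated[where w = "\<lambda>z. 2 * cmod (f z)"] s f) auto
  have "(\<lambda>n. ennreal ((norm (ssi (s n) x))\<^sup>2)) \<longlonglongrightarrow> (\<integral>\<^sup>+z. ennreal ((cmod (f z))\<^sup>2) \<partial>\<mu> x)"
    unfolding ssi_isometry[OF s(1)]
  proof (rule nn_integral_dominated_convergence[where w = "\<lambda>z. ennreal ((2 * cmod (f z))\<^sup>2)"])
    show "AE z in \<mu> x. ennreal ((cmod (s n z))\<^sup>2) \<le> ennreal ((2 * cmod (f z))\<^sup>2)" for n
      using s(3) by (intro AE_I2 ennreal_leI power_mono) auto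
    show "AE z in \<mu> x. (\<lambda>n. ennreal ((cmod (s n z))\<^sup>2)) \<longlonglongrightarrow> ennreal ((cmod (f z))\<^sup>2)"
      using s(2) by (intro AE_I2 tendsto_ennrealI tendsto_intros) auto
  qed (use fin in measurable)
  moreover have "(\<lambda>n. ennreal ((norm (ssi (s n) x))\<^sup>2)) \<longlonglongrightarrow> ennreal ((norm y)\<^sup>2)"
    by (intro tendsto_ennrealI tendsto_intros hsi_ssi_tendsto[OF hsi] s lim)
  ultimately show ?thesis
    by (rule LIMSEQ_unique[rotated])
qed

lemma hsi_scaleC:
  assumes "hsi f x y"
  shows "hsi (\<lambda>z. c * f z) x (c *\<^sub>C y)"
proof -
  note [measurable] = hsi_measurable[OF assms]
  obtain s where s: "\<And>n. simple_function BS (s n)" "(\<lambda>n. dist2 x f (s n)) \<longlonglongrightarrow> 0"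
      "(\<lambda>n. ssi (s n) x) \<longlonglongrightarrow> y"
    using assms unfolding hsi_def by blast
  note [measurable] = simple_measurable[OF s(1)]
  have "dist2 x (\<lambda>z. c * f z) (\<lambda>z. c * s n z) = ennreal ((cmod c)\<^sup>2) * dist2 x f (s n)" for n
    by (simp add: dist2_def norm_mult power_mult_distrib ennreal_mult nn_integral_cmult
        flip: right_diff_distrib)
  then have "(\<lambda>n. dist2 x (\<lambda>z. c * f z) (\<lambda>z. c * s n z)) \<longlonglongrightarrow> 0"
    using ennreal_tendsto_cmult[OF _ s(2), of "ennreal ((cmod c)\<^sup>2)"] by simp
  moreover have "(\<lambda>n. ssi (\<lambda>z. c * s n z) x) \<longlonglongrightarrow> c *\<^sub>C y"
    unfolding ssi_scaleC[OF s(1)] by (intro tendsto_intros s(3))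
  moreover have "simple_function BS (\<lambda>z. c * s n z)" for n
    using s(1) by (intro simple_function_mult simple_function_const)
  ultimately show ?thesis
    unfolding hsi_def by (intro conjI exI[of _ "\<lambda>n z. c * s n z"]) auto
qed

lemma hsi_add:
  assumes f: "hsi f x y" and h: "hsi h x w"
  shows "hsi (\<lambda>z. f z + h z) x (y + w)"
proof -
  note [measurable] = hsi_measurable[OF f] hsi_measurable[OF h]
  obtain s where s: "\<And>n. simple_function BS (s n)" "(\<lambda>n. dist2 x f (s n)) \<longlonglongrightarrow> 0"
      "(\<lambda>n. ssi (s n) x) \<longlonglongrightarrow> y"
    using f unfolding hsi_def by blast
  obtain t where t: "\<And>n. simple_function BS (t n)" "(\<lambda>n. dist2 x h (t n)) \<longlonglongrightarrow> 0"
      "(\<lambda>n. ssi (t n) x) \<longlonglongrightarrow> w"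
    using h unfolding hsi_def by blast
  note [measurable] = simple_measurable[OF s(1)] simple_measurable[OF t(1)]
  have "(\<lambda>n. dist2 x (\<lambda>z. f z + h z) (\<lambda>z. s n z + h z)) \<longlonglongrightarrow> 0"
    using s(2) by (simp add: dist2_def)
  moreover have "(\<lambda>n. dist2 x (\<lambda>z. s n z + h z) (\<lambda>z. s n z + t n z)) \<longlonglongrightarrow> 0"
    using t(2) by (simp add: dist2_def)
  ultimately have lim: "(\<lambda>n. 2 * dist2 x (\<lambda>z. f z + h z) (\<lambda>z. s n z + h z)
      + 2 * dist2 x (\<lambda>z. s n z + h z) (\<lambda>z. s n z + t n z)) \<longlonglongrightarrow> 2 * 0 + 2 * 0"
    by (intro tendsto_add ennreal_tendsto_cmult) auto
  have "(\<lambda>n. dist2 x (\<lambda>z. f z + h z) (\<lambda>z. s n z + t n z)) \<longlonglongrightarrow> 0"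
  proof (rule tendsto_sandwich[where f = "\<lambda>_. 0"])
    show "\<forall>\<^sub>F n in sequentially. dist2 x (\<lambda>z. f z + h z) (\<lambda>z. s n z + t n z)
        \<le> 2 * dist2 x (\<lambda>z. f z + h z) (\<lambda>z. s n z + h z)
          + 2 * dist2 x (\<lambda>z. s n z + h z) (\<lambda>z. s n z + t n z)"
      by (intro always_eventually allI dist2_triangle) measurable
  qed (use lim in auto)
  moreover have "(\<lambda>n. ssi (\<lambda>z. s n z + t n z) x) \<longlonglongrightarrow> y + w"
    unfolding ssi_add[OF s(1) t(1)] by (intro tendsto_intros s(3) t(3))
  moreover have "simple_function BS (\<lambda>z. s n z + t n z)" for n
    using s(1) t(1) by (intro simple_function_add)
  ultimately show ?thesis
    unfolding hsi_def by (intro conjI exI[of _ "\<lambda>n z. s n z + t n z"]) auto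
qed

lemma hsi_diff:
  assumes "hsi f x y" "hsi h x w"
  shows "hsi (\<lambda>z. f z - h z) x (y - w)"
  using hsi_add[OF assms(1) hsi_scaleC[OF assms(2), of "-1"]] by (simp add: scaleC_one)

lemma hsi_dist2:
  assumes "hsi f x y" "hsi h x w"
  shows "ennreal ((norm (y - w))\<^sup>2) = dist2 x f h"
  using hsi_isometry[OF hsi_diff[OF assms]] by (simp add: dist2_def)

text \<open>Here the limit integrand is given. Producing one from convergent values is the task of
  \<open>hsi_closed_range\<close>.\<close>

lemma hsi_limit:
  assumes f: "f \<in> borel_measurable BS" and u: "\<And>n. hsi (u n) x (y n)"
    and lim: "(\<lambda>n. dist2 x f (u n)) \<longlonglongrightarrow> 0"
  shows "\<exists>w. hsi f x w \<and> y \<longlonglongrightarrow> w"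
proof -
  obtain n where n: "dist2 x f (u n) < 1"
    using order_tendstoD(2)[OF lim, of 1] unfolding eventually_sequentially by force
  have "(\<integral>\<^sup>+z. ennreal ((cmod (f z))\<^sup>2) \<partial>\<mu> x) = dist2 x f (\<lambda>_. 0)"
    by (simp add: dist2_def)
  also have "\<dots> \<le> 2 * dist2 x f (u n) + 2 * dist2 x (u n) (\<lambda>_. 0)"
    using f hsi_measurable[OF u] by (intro dist2_triangle) auto
  also have "\<dots> < \<infinity>"
    using order.strict_trans[OF n ennreal_one_less_top] hsi_finite[OF u, of n]
    by (simp add: dist2_def ennreal_mult_less_top)
  finally obtain w where w: "hsi f x w"
    using hsi_exists[OF f] by blast
  have "(\<lambda>n. w - y n) \<longlonglongrightarrow> 0"
    using lim unfolding hsi_dist2[OF w u, symmetric] tendsto_0_iff_ennreal_power2_norm .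
  from tendsto_diff[OF tendsto_const[of w] this] have "y \<longlonglongrightarrow> w"
    by simp
  with w show ?thesis
    by blast
qed

lemma hsi_cong_AE:
  assumes "hsi f x y" "h \<in> borel_measurable BS" "AE z in \<mu> x. f z = h z"
  shows "hsi h x y"
proof -
  have "dist2 x f s = dist2 x h s" for s
    unfolding dist2_def using assms(3) by (intro nn_integral_cong_AE) auto
  with assms(1,2) show ?thesis
    by (simp add: hsi_def)
qed

lemma hsi_eq_0_imp_AE:
  assumes "hsi f x 0"
  shows "AE z in \<mu> x. f z = 0"
proof -
  note [measurable] = hsi_measurable[OF assms]
  have "AE z in \<mu> x. ennreal ((cmod (f z))\<^sup>2) = 0"
    using hsi_isometry[OF assms] by (subst nn_integral_0_iff_AE[symmetric]) auto
  then show ?thesis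
    by eventually_elim simp
qed


section \<open>Multiplication by bounded functions\<close>

lemma finite_nn_integral_const: "(\<integral>\<^sup>+z. ennreal c \<partial>\<mu> x) < \<infinity>"
  by (simp add: emeasure_\<mu>_space ennreal_mult_less_top)

text \<open>A simple function has finite range, so multiplying by it preserves
  \<open>L\<^sup>2\<close> convergence, while \<open>ssi s\<close> is continuous on the side of the
  values.\<close>

lemma hsi_simple_mult:
  assumes s: "simple_function BS s" and h: "hsi h x y"
  shows "hsi (\<lambda>z. s z * h z) x (ssi s y)"
proof -
  note [measurable] = hsi_measurable[OF h] simple_measurable[OF s]
  obtain t where t: "\<And>n. simple_function BS (t n)" "(\<lambda>n. dist2 x h (t n)) \<longlonglongrightarrow> 0"
      "(\<lambda>n. ssi (t n) x) \<longlonglongrightarrow> y"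
    using h unfolding hsi_def by blast
  note [measurable] = simple_measurable[OF t(1)]
  obtain B where B: "\<And>z. z \<in> S \<Longrightarrow> cmod (s z) \<le> B"
    using finite_imp_bounded[OF simple_BS(1)[OF s]] unfolding bounded_iff by auto
  have le: "dist2 x (\<lambda>z. s z * h z) (\<lambda>z. s z * t n z) \<le> ennreal (B\<^sup>2) * dist2 x h (t n)" for n
  proof -
    have "dist2 x (\<lambda>z. s z * h z) (\<lambda>z. s z * t n z)
        \<le> (\<integral>\<^sup>+z. ennreal (B\<^sup>2) * ennreal ((cmod (h z - t n z))\<^sup>2) \<partial>\<mu> x)"
      unfolding dist2_def
    proof (rule nn_integral_mono)
      fix z assume "z \<in> space (\<mu> x)"
      then have "(cmod (s z))\<^sup>2 \<le> B\<^sup>2"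
        using B by (intro power_mono) auto
      then have "(cmod (s z * h z - s z * t n z))\<^sup>2 \<le> B\<^sup>2 * (cmod (h z - t n z))\<^sup>2"
        by (simp add: norm_mult power_mult_distrib mult_right_mono flip: right_diff_distrib)
      then show "ennreal ((cmod (s z * h z - s z * t n z))\<^sup>2)
          \<le> ennreal (B\<^sup>2) * ennreal ((cmod (h z - t n z))\<^sup>2)"
        by (simp add: ennreal_leI flip: ennreal_mult)
    qed
    then show ?thesis
      by (simp add: dist2_def nn_integral_cmult)
  qed
  have "(\<lambda>n. ennreal (B\<^sup>2) * dist2 x h (t n)) \<longlonglongrightarrow> 0"
    using ennreal_tendsto_cmult[OF _ t(2), of "ennreal (B\<^sup>2)"] by simp
  from tendsto_sandwich[OF _ always_eventually tendsto_const this]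
  have "(\<lambda>n. dist2 x (\<lambda>z. s z * h z) (\<lambda>z. s z * t n z)) \<longlonglongrightarrow> 0"
    using le by simp
  moreover have "(\<lambda>n. ssi (\<lambda>z. s z * t n z) x) \<longlonglongrightarrow> ssi s y"
    unfolding ssi_mult[OF s t(1)] using bounded_clinear_ssi[OF s]
    by (intro bounded_linear.tendsto[OF _ t(3)]) (simp add: bounded_clinear_def)
  moreover have "simple_function BS (\<lambda>z. s z * t n z)" for n
    using s t(1) by (intro simple_function_mult)
  ultimately show ?thesis
    unfolding hsi_def by (intro conjI exI[of _ "\<lambda>n z. s z * t n z"]) auto
qed

lemma bounded_dist2_tendsto:
  assumes f: "f \<in> borel_measurable BS" and bd: "\<And>z. z \<in> S \<Longrightarrow> cmod (f z) \<le> B"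
    and s: "\<And>n. simple_function BS (s n)" "\<And>z. z \<in> S \<Longrightarrow> (\<lambda>n. s n z) \<longlonglongrightarrow> f z"
      "\<And>n z. z \<in> S \<Longrightarrow> cmod (s n z) \<le> 2 * cmod (f z)"
  shows "(\<lambda>n. dist2 x f (s n)) \<longlonglongrightarrow> 0"
proof (rule dist2_tendsto_dominated[where w = "\<lambda>_. 2 * B"])
  show "cmod (s n z) \<le> 2 * B" if "z \<in> S" for n z
    using s(3)[OF that, of n] bd[OF that] by linarith
qed (use finite_nn_integral_const in \<open>auto intro!: f s simple_measurable\<close>)

lemma hsi_bounded_exists:
  assumes f: "f \<in> borel_measurable BS" and bd: "\<And>z. z \<in> S \<Longrightarrow> cmod (f z) \<le> B"
  shows "\<exists>y. hsi f x y"
proof (rule hsi_exists[OF f])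
  have "(\<integral>\<^sup>+z. ennreal ((cmod (f z))\<^sup>2) \<partial>\<mu> x) \<le> (\<integral>\<^sup>+z. ennreal (B\<^sup>2) \<partial>\<mu> x)"
    using bd by (intro nn_integral_mono ennreal_leI power_mono) auto
  also have "\<dots> < \<infinity>"
    by (rule finite_nn_integral_const)
  finally show "(\<integral>\<^sup>+z. ennreal ((cmod (f z))\<^sup>2) \<partial>\<mu> x) < \<infinity>" .
qed

text \<open>The bounded factor \<open>f\<close> is the one approximated. The same simple functions
  work over \<open>\<mu> x\<close>, where \<open>2 * B * cmod (h z)\<close> dominates, and over
  \<open>\<mu> y\<close>, where a constant does; the two limits are then compared. The factor
  \<open>h\<close> may be unbounded.\<close>

lemma hsi_mult:
  assumes F: "\<And>y. hsi f y (F y)" and bd: "\<And>z. z \<in> S \<Longrightarrow> cmod (f z) \<le> B" and h: "hsi h x y"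
  shows "hsi (\<lambda>z. f z * h z) x (F y)"
proof -
  note f [measurable] = hsi_measurable[OF F] and [measurable] = hsi_measurable[OF h]
  obtain s where s: "\<And>n. simple_function BS (s n)" "\<And>z. z \<in> S \<Longrightarrow> (\<lambda>n. s n z) \<longlonglongrightarrow> f z"
    "\<And>n z. z \<in> S \<Longrightarrow> cmod (s n z) \<le> 2 * cmod (f z)"
    using ex_simple_approx[OF f] by metis
  note [measurable] = simple_measurable[OF s(1)]
  have "(\<lambda>n. dist2 x (\<lambda>z. f z * h z) (\<lambda>z. s n z * h z)) \<longlonglongrightarrow> 0"
  proof (rule dist2_tendsto_dominated[where w = "\<lambda>z. 2 * B * cmod (h z)"])
    show "cmod (s n z * h z) \<le> 2 * B * cmod (h z)" if "z \<in> S" for n z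
      using s(3)[OF that, of n] bd[OF that] by (simp add: norm_mult mult_right_mono)
    have "(\<integral>\<^sup>+z. ennreal ((2 * B * cmod (h z))\<^sup>2) \<partial>\<mu> x)
        = ennreal ((2 * B)\<^sup>2) * (\<integral>\<^sup>+z. ennreal ((cmod (h z))\<^sup>2) \<partial>\<mu> x)"
      unfolding power_mult_distrib[of "2 * B"] by (simp add: ennreal_mult nn_integral_cmult)
    then show "(\<integral>\<^sup>+z. ennreal ((2 * B * cmod (h z))\<^sup>2) \<partial>\<mu> x) < \<infinity>"
      using hsi_finite[OF h] by (simp add: ennreal_mult_less_top)
    show "(\<lambda>n. s n z * h z) \<longlonglongrightarrow> f z * h z" if "z \<in> S" for z
      by (intro tendsto_intros s that)
  qed measurable
  then obtain w where w: "hsi (\<lambda>z. f z * h z) x w" "(\<lambda>n. ssi (s n) y) \<longlonglongrightarrow> w"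
    using hsi_limit[of "\<lambda>z. f z * h z" "\<lambda>n z. s n z * h z" x "\<lambda>n. ssi (s n) y"]
      borel_measurable_times[OF f hsi_measurable[OF h]] hsi_simple_mult[OF s(1) h] by blast
  have "(\<lambda>n. ssi (s n) y) \<longlonglongrightarrow> F y"
    by (intro hsi_ssi_tendsto[OF F] bounded_dist2_tendsto[OF f bd] s)
  with w show ?thesis
    using LIMSEQ_unique by blast
qed

text \<open>One sequence approximates \<open>f\<close> over \<open>\<mu> y\<close> and, conjugated,
  \<open>cnj\<close> of \<open>f\<close> over \<open>\<mu> x\<close>; the identity for simple
  functions passes to the limit.\<close>

lemma hsi_adjoint:
  assumes F: "\<And>y. hsi f y (F y)" and T: "\<And>y. hsi (\<lambda>z. cnj (f z)) y (T y)"
    and bd: "\<And>z. z \<in> S \<Longrightarrow> cmod (f z) \<le> B"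
  shows "cinner (T x) y = cinner x (F y)"
proof -
  note f = hsi_measurable[OF F]
  obtain s where s: "\<And>n. simple_function BS (s n)" "\<And>z. z \<in> S \<Longrightarrow> (\<lambda>n. s n z) \<longlonglongrightarrow> f z"
    "\<And>n z. z \<in> S \<Longrightarrow> cmod (s n z) \<le> 2 * cmod (f z)"
    using ex_simple_approx[OF f] by metis
  have s': "simple_function BS (\<lambda>z. cnj (s n z))" for n
    by (rule simple_function_compose1[OF s(1)])
  have "(\<lambda>n. ssi (\<lambda>z. cnj (s n z)) x) \<longlonglongrightarrow> T x"
    using s s' bd
    by (intro hsi_ssi_tendsto[OF T] bounded_dist2_tendsto[where B = B] hsi_measurable[OF T])
      (auto intro!: tendsto_cnj)
  then have "(\<lambda>n. cinner (ssi (\<lambda>z. cnj (s n z)) x) y) \<longlonglongrightarrow> cinner (T x) y"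
    by (intro tendsto_intros)
  moreover have "(\<lambda>n. ssi (s n) y) \<longlonglongrightarrow> F y"
    by (intro hsi_ssi_tendsto[OF F] bounded_dist2_tendsto[OF f bd] s)
  then have "(\<lambda>n. cinner x (ssi (s n) y)) \<longlonglongrightarrow> cinner x (F y)"
    by (intro tendsto_intros)
  ultimately show ?thesis
    unfolding ssi_adjoint[OF s(1)] by (rule LIMSEQ_unique)
qed

section \<open>The integrals of a fixed vector form a closed subspace\<close>

text \<open>Riesz-Fischer: along a fast subsequence the integrands converge almost everywhere, because
  \<open>\<bar>d\<bar> \<le> t + \<bar>d\<bar>\<^sup>2 / t\<close> bounds the sum of the differences \<open>d\<close> by their \<open>L\<^sup>2\<close> norms.\<close>

lemma hsi_closed_range:
  assumes f: "\<And>n. hsi (f n) x (y n)" and y: "y \<longlonglongrightarrow> w"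
  shows "\<exists>h. hsi h x w"
proof -
  \<comment> \<open>This rate makes consecutive values differ by at most \<open>(1/4) ^ k\<close>,
    hence the integrals of the squared differences are at most \<open>(1/16) ^ k\<close>. The
    indices need not increase, since only closeness to \<open>w\<close> matters.\<close>
  have "\<exists>n. norm (y n - w) < (1/4) ^ k / 2" for k
    using LIMSEQ_D[OF y, of "(1/4) ^ k / 2"] by auto
  then obtain n where n: "\<And>k. norm (y (n k) - w) < (1/4) ^ k / 2"
    by metis
  define F where "F k = f (n k)" for k
  define v where "v k = y (n k)" for k
  have F: "hsi (F k) x (v k)" for k
    by (simp add: F_def v_def f)
  note [measurable] = hsi_measurable[OF F]
  have v: "v \<longlonglongrightarrow> w"
  proof (rule LIM_zero_cancel, rule Lim_null_comparison)
    show "\<forall>\<^sub>F k in sequentially. norm (v k - w) \<le> (1/4) ^ k / 2"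
      using n by (intro always_eventually allI less_imp_le) (simp add: v_def)
    show "(\<lambda>k. (1/4) ^ k / 2 :: real) \<longlonglongrightarrow> 0"
      using tendsto_divide[OF LIMSEQ_power_zero[of "1/4 :: real"] tendsto_const[of 2]] by simp
  qed
  define d where "d k z = F (Suc k) z - F k z" for k z
  have d: "(\<integral>\<^sup>+z. ennreal ((cmod (d k z))\<^sup>2) \<partial>\<mu> x) \<le> ennreal ((1/16) ^ k)" for k
  proof -
    have "norm (v (Suc k) - v k) \<le> norm (v (Suc k) - w) + norm (v k - w)"
      using norm_triangle_ineq4[of "v (Suc k) - w" "v k - w"] by simp
    also have "\<dots> \<le> (1/4) ^ Suc k / 2 + (1/4) ^ k / 2"
      unfolding v_def by (intro add_mono less_imp_le n)
    also have "\<dots> \<le> (1/4) ^ k"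
      by simp
    finally have "(norm (v (Suc k) - v k))\<^sup>2 \<le> ((1/4) ^ k)\<^sup>2"
      by (intro power_mono) auto
    also have "((1/4) ^ k)\<^sup>2 = ((1/16) ^ k :: real)"
      by (simp add: power2_eq_square flip: power_mult_distrib)
    finally have "ennreal ((norm (v (Suc k) - v k))\<^sup>2) \<le> ennreal ((1/16) ^ k)"
      by (rule ennreal_leI)
    then show ?thesis
      unfolding hsi_dist2[OF F F] by (simp add: dist2_def d_def)
  qed
  have [measurable]: "d k \<in> borel_measurable BS" for k
    unfolding d_def by measurable
  define C where "C = (norm x)\<^sup>2"
  have d1: "(\<integral>\<^sup>+z. ennreal (cmod (d k z)) \<partial>\<mu> x) \<le> ennreal ((1/2) ^ k * (C + 1))" for k
  proof -
    \<comment> \<open>The threshold is \<open>t = (1/2) ^ k\<close>: the constant term sums over the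
      finite total mass \<open>C\<close>, and \<open>2 ^ k * (1/16) ^ k = (1/8) ^ k\<close> is
      summable too.\<close>
    have pw: "cmod (d k z) \<le> (1/2) ^ k + 2 ^ k * (cmod (d k z))\<^sup>2" for z
    proof (cases "cmod (d k z) \<le> (1/2) ^ k")
      case False
      then have "1 \<le> 2 ^ k * cmod (d k z)"
        by (simp add: field_simps power_divide)
      then have "cmod (d k z) * 1 \<le> cmod (d k z) * (2 ^ k * cmod (d k z))"
        by (intro mult_left_mono) auto
      then have "cmod (d k z) \<le> 2 ^ k * (cmod (d k z))\<^sup>2"
        by (simp add: power2_eq_square ac_simps)
      then show ?thesis
        by (simp add: add_increasing)
    qed (simp add: add_increasing2)
    have "(\<integral>\<^sup>+z. ennreal (cmod (d k z)) \<partial>\<mu> x)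
        \<le> (\<integral>\<^sup>+z. ennreal ((1/2) ^ k) + ennreal (2 ^ k) * ennreal ((cmod (d k z))\<^sup>2) \<partial>\<mu> x)"
    proof (rule nn_integral_mono)
      fix z
      show "ennreal (cmod (d k z))
          \<le> ennreal ((1/2) ^ k) + ennreal (2 ^ k) * ennreal ((cmod (d k z))\<^sup>2)"
        using ennreal_leI[OF pw[of z]] by (simp add: ennreal_mult)
    qed
    also have "\<dots> = ennreal ((1/2) ^ k) * ennreal C
        + ennreal (2 ^ k) * (\<integral>\<^sup>+z. ennreal ((cmod (d k z))\<^sup>2) \<partial>\<mu> x)"
      by (subst nn_integral_add) (simp_all add: nn_integral_cmult emeasure_\<mu>_space C_def)
    also have "\<dots> \<le> ennreal ((1/2) ^ k) * ennreal C + ennreal (2 ^ k) * ennreal ((1/16) ^ k)"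
      by (intro add_left_mono mult_left_mono d) simp
    also have "\<dots> = ennreal ((1/2) ^ k * C + 2 ^ k * (1/16) ^ k)"
      by (simp add: C_def ennreal_mult)
    also have "\<dots> \<le> ennreal ((1/2) ^ k * (C + 1))"
    proof (rule ennreal_leI)
      have "2 ^ k * (1/16) ^ k = ((1/8) ^ k :: real)"
        by (simp flip: power_mult_distrib)
      also have "\<dots> \<le> (1/2) ^ k"
        by (intro power_mono) auto
      finally show "(1/2) ^ k * C + 2 ^ k * (1/16) ^ k \<le> (1/2) ^ k * (C + 1)"
        by (simp add: algebra_simps)
    qed
    finally show ?thesis .
  qed
  have "(\<integral>\<^sup>+z. (\<Sum>k. ennreal (cmod (d k z))) \<partial>\<mu> x) = (\<Sum>k. \<integral>\<^sup>+z. ennreal (cmod (d k z)) \<partial>\<mu> x)"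
    by (intro nn_integral_suminf) measurable
  also have "\<dots> \<le> (\<Sum>k. ennreal ((1/2) ^ k * (C + 1)))"
    by (intro suminf_le d1) auto
  also have "\<dots> < \<infinity>"
  proof -
    have "summable (\<lambda>k. (1/2) ^ k * (C + 1) :: real)"
      by (intro summable_mult2 summable_geometric) simp
    moreover have "0 \<le> (1/2) ^ k * (C + 1)" for k
      by (simp add: C_def)
    ultimately show ?thesis
      unfolding infinity_ennreal_def less_top[symmetric] by (rule ennreal_suminf_neq_top)
  qed
  finally have "AE z in \<mu> x. (\<Sum>k. ennreal (cmod (d k z))) \<noteq> \<infinity>"
    by (intro nn_integral_PInf_AE) auto
  then have conv: "AE z in \<mu> x. convergent (\<lambda>k. F k z)"
  proof eventually_elim
    case (elim z)
    then have "summable (\<lambda>k. d k z)"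
      by (intro summable_norm_cancel[OF summable_suminf_not_top]) auto
    then have "convergent (\<lambda>k. \<Sum>j<k. d j z)"
      by (simp add: summable_iff_convergent)
    then have "convergent (\<lambda>k. F 0 z + (\<Sum>j<k. d j z))"
      by (intro convergent_add convergent_const)
    moreover have "F 0 z + (\<Sum>j<k. d j z) = F k z" for k
      using sum_lessThan_telescope[of "\<lambda>k. F k z" k] by (simp add: d_def)
    ultimately show ?case
      by simp
  qed
  \<comment> \<open>Where the sequence diverges the value of \<open>lim\<close> is arbitrary, but
    this happens on a null set only.\<close>
  define h where "h z = lim (\<lambda>k. F k z)" for z
  have h [measurable]: "h \<in> borel_measurable BS"
    unfolding h_def by measurable
  have le: "dist2 x h (F k) \<le> ennreal ((norm (w - v k))\<^sup>2)" for k
  proof -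
    \<comment> \<open>Fatou's lemma bounds the distance from \<open>h\<close> by distances within
      the sequence, which the isometry turns into distances of values.\<close>
    have "dist2 x h (F k) = (\<integral>\<^sup>+z. liminf (\<lambda>m. ennreal ((cmod (F m z - F k z))\<^sup>2)) \<partial>\<mu> x)"
      unfolding dist2_def
    proof (rule nn_integral_cong_AE)
      show "AE z in \<mu> x. ennreal ((cmod (h z - F k z))\<^sup>2)
          = liminf (\<lambda>m. ennreal ((cmod (F m z - F k z))\<^sup>2))"
        using conv
      proof eventually_elim
        case (elim z)
        then have "(\<lambda>m. F m z) \<longlonglongrightarrow> h z"
          by (simp add: h_def convergent_LIMSEQ_iff)
        then show ?case
          by (intro lim_imp_Liminf[symmetric] tendsto_ennrealI tendsto_intros) auto
      qed
    qed
    also have "\<dots> \<le> liminf (\<lambda>m. dist2 x (F m) (F k))"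
      unfolding dist2_def by (intro nn_integral_liminf) measurable
    also have "\<dots> = ennreal ((norm (w - v k))\<^sup>2)"
      unfolding hsi_dist2[OF F F, symmetric]
      by (intro lim_imp_Liminf tendsto_ennrealI tendsto_intros v) auto
    finally show ?thesis .
  qed
  have "(\<lambda>k. ennreal ((norm (w - v k))\<^sup>2)) \<longlonglongrightarrow> 0"
    unfolding tendsto_0_iff_ennreal_power2_norm
    using tendsto_diff[OF tendsto_const v, of w] by simp
  from tendsto_sandwich[OF _ always_eventually tendsto_const this]
  have "(\<lambda>k. dist2 x h (F k)) \<longlonglongrightarrow> 0"
    using le by simp
  from hsi_limit[OF h F this] show ?thesis
    using LIMSEQ_unique[OF v] by blast
qed

text \<open>This rests on \<open>E S = id\<close> and makes \<open>x\<close> itself the image of the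
  constant 1, the start of the induction over powers of \<open>z\<close>.\<close>

lemma hsi_one: "hsi (\<lambda>_. 1) x x"
proof -
  have "ssi (\<lambda>_. 1) x = x"
    using ssi_compose[of "\<lambda>_. 1 :: complex" "{1}" "\<lambda>c. c" x]
    by (simp add: E_S scaleC_one image_subset_iff)
  then show ?thesis
    using hsi_simple[of "\<lambda>_. 1" x] by simp
qed

lemma closure_krylov_subset_range:
  assumes F: "\<And>y. hsi (\<lambda>z. z) y (A y)" and bd: "\<And>z. z \<in> S \<Longrightarrow> cmod z \<le> B"
    and w: "w \<in> closure (krylov A x)"
  shows "\<exists>h. hsi h x w"
proof -
  define R where "R = {y. \<exists>h. hsi h x y}"
  have "complex_vector.subspace R"
  proof (rule complex_vector.subspaceI)
    show "0 \<in> R"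
      using hsi_scaleC[OF hsi_one, of 0 x] by (auto simp: R_def)
  qed (auto simp: R_def intro: hsi_add hsi_scaleC)
  moreover have "hsi (\<lambda>z. z ^ k) x ((A ^^ k) x)" for k
    by (induction k) (simp_all add: hsi_one hsi_mult[OF F bd])
  then have "{(A ^^ k) x | k. True} \<subseteq> R"
    by (auto simp: R_def)
  ultimately have "krylov A x \<subseteq> R"
    unfolding krylov_def by (intro complex_vector.span_minimal)
  then have R: "\<exists>h. hsi h x y" if "y \<in> krylov A x" for y
    using that by (auto simp: R_def)
  obtain y where y: "\<And>n. y n \<in> krylov A x" "y \<longlonglongrightarrow> w"
    using w unfolding closure_sequential by blast
  have "\<forall>n. \<exists>h. hsi h x (y n)"
    using R y(1) by blast
  from choice[OF this] obtain h where "\<And>n. hsi (h n) x (y n)"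
    by blast
  then show ?thesis
    using y(2) by (rule hsi_closed_range)
qed


section \<open>Integrals stay in closed reducing subspaces\<close>

lemma ssi_indicator:
  assumes "\<Omega> \<in> sets borel" "\<Omega> \<subseteq> S"
  shows "ssi (indicator \<Omega>) x = E \<Omega> x"
proof -
  have "simple_function BS (indicator \<Omega> :: complex \<Rightarrow> complex)"
    using assms by (intro simple_function_indicator) (simp add: sets_BS_iff)
  moreover have "indicator \<Omega> -` {1 :: complex} \<inter> S = \<Omega>"
    using assms by (auto simp: indicator_def split: if_splits)
  moreover have "indicator \<Omega> ` S \<subseteq> {0, 1 :: complex}"
    by (auto simp: indicator_def)
  ultimately show ?thesis
    using ssi_compose[of "indicator \<Omega> :: complex \<Rightarrow> complex" "{0, 1}" "\<lambda>c. c" x]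
    by (simp add: scaleC_one)
qed

lemma hsi_in_reducing_subspace:
  assumes S: "compact S"
    and M: "complex_vector.subspace M" "closed M" and x: "x \<in> M"
    and F: "\<And>y. hsi (\<lambda>z. z) y (F y)" "F ` M \<subseteq> M"
    and T: "\<And>y. hsi cnj y (T y)" "T ` M \<subseteq> M"
    and f: "hsi f x y"
  shows "y \<in> M"
proof -
  obtain B where B: "\<And>z. z \<in> S \<Longrightarrow> cmod z \<le> B"
    using compact_imp_bounded[OF S] unfolding bounded_iff by blast
  define V where "V h \<longleftrightarrow> (\<exists>w\<in>M. hsi h x w)" for h
  have V_meas: "h \<in> borel_measurable BS" if "V h" for h
    using that hsi_measurable by (auto simp: V_def)
  have V_add: "V (\<lambda>z. h z + k z)" if "V h" "V k" for h k
    using that hsi_add complex_vector.subspace_add[OF M(1)] unfolding V_def by meson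
  have V_scale: "V (\<lambda>z. c * h z)" if "V h" for h c
    using that hsi_scaleC complex_vector.subspace_scale[OF M(1)] unfolding V_def by meson
  have V_one: "V (\<lambda>_. 1)"
    using hsi_one x by (auto simp: V_def)
  have V_id: "V (\<lambda>z. z * h z)" if "V h" for h
    using that hsi_mult[OF F(1) B] F(2) unfolding V_def by blast
  have V_cnj: "V (\<lambda>z. cnj z * h z)" if "V h" for h
    using that hsi_mult[OF T(1), of B] B T(2) unfolding V_def complex_mod_cnj by blast
  \<comment> \<open>Bounded pointwise limits suffice for everything up to indicators: the constant
    \<open>K\<close> is square integrable because \<open>\<mu> x\<close> is finite.\<close>
  have V_limit: "V h" if h: "h \<in> borel_measurable BS" and u: "\<And>n. V (u n)"
      and lim: "\<And>z. z \<in> S \<Longrightarrow> (\<lambda>n. u n z) \<longlonglongrightarrow> h z"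
      and bd: "\<And>n z. z \<in> S \<Longrightarrow> cmod (u n z) \<le> K"
    for h u K
  proof -
    obtain w where w: "\<And>n. w n \<in> M" "\<And>n. hsi (u n) x (w n)"
      using u unfolding V_def by metis
    have "(\<lambda>n. dist2 x h (u n)) \<longlonglongrightarrow> 0"
      using finite_nn_integral_const V_meas[OF u] h lim bd
      by (intro dist2_tendsto_dominated[where w = "\<lambda>_. K"]) auto
    then obtain w' where "hsi h x w'" "w \<longlonglongrightarrow> w'"
      using hsi_limit[of h u x w] h w(2) by blast
    then show ?thesis
      using closed_sequentially[OF M(2)] w(1) unfolding V_def by blast
  qed
  \<comment> \<open>Carrying the factor \<open>h\<close> along makes the product case immediate: the
    hypothesis for \<open>p\<close> is applied to \<open>q\<close> times \<open>h\<close>.\<close>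
  have V_poly: "V (\<lambda>z. of_real (p z) * h z)" if "real_polynomial_function p" "V h" for p h
    using that
  proof (induction p arbitrary: h rule: real_polynomial_function.induct)
    case (linear p)
    \<comment> \<open>A real-linear \<open>p\<close> is \<open>Re z * p 1 + Im z * p \<i>\<close>;
      writing the two parts through \<open>z\<close> and \<open>cnj z\<close> reduces it to the two
      available multipliers.\<close>
    have "of_real (p z) * h z = (of_real (p 1) / 2 + of_real (p \<i>) / (2 * \<i>)) * (z * h z)
        + (of_real (p 1) / 2 - of_real (p \<i>) / (2 * \<i>)) * (cnj z * h z)" for z
    proof -
      have "p z = p (Re z *\<^sub>R 1 + Im z *\<^sub>R \<i>)"
        by (rule arg_cong[where f = p]) (simp add: complex_eq_iff)
      also have "\<dots> = Re z * p 1 + Im z * p \<i>"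
        using linear.hyps by (simp add: bounded_linear.linear linear_add linear_scale)
      finally have p: "complex_of_real (p z)
          = (z + cnj z) / 2 * of_real (p 1) + (z - cnj z) / (2 * \<i>) * of_real (p \<i>)"
        by (simp add: complex_eq_iff)
      show ?thesis
        unfolding p by (simp add: field_simps)
    qed
    then show ?case
      using linear.prems by (simp only: ) (intro V_add V_scale V_id V_cnj)
  next
    case (const c)
    then show ?case
      by (rule V_scale)
  next
    case (add p q)
    have "V (\<lambda>z. of_real (p z) * h z + of_real (q z) * h z)"
      using add by (intro V_add) auto
    then show ?case
      by (simp add: algebra_simps)
  next
    case (mult p q)
    have "V (\<lambda>z. of_real (p z) * (of_real (q z) * h z))"
      using mult by blast
    then show ?case
      by (simp add: algebra_simps)
  qed
  have V_cont: "V (\<lambda>z. of_real (\<phi> z))" if \<phi>: "continuous_on S \<phi>" for \<phi> :: "complex \<Rightarrow> real"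
  proof -
    have "\<exists>p. real_polynomial_function p \<and> (\<forall>z\<in>S. \<bar>\<phi> z - p z\<bar> < 1 / real (Suc n))" for n
      using Stone_Weierstrass_real_polynomial_function[OF S \<phi>, of "1 / real (Suc n)"]
      by (metis of_nat_0_less_iff zero_less_Suc zero_less_divide_1_iff)
    then obtain p where p: "\<And>n. real_polynomial_function (p n)"
        and p_le: "\<And>n z. z \<in> S \<Longrightarrow> \<bar>\<phi> z - p n z\<bar> < 1 / real (Suc n)"
      by metis
    obtain K where K: "\<And>z. z \<in> S \<Longrightarrow> \<bar>\<phi> z\<bar> \<le> K"
      using compact_imp_bounded[OF compact_continuous_image[OF \<phi> S]]
      unfolding bounded_iff by auto
    show ?thesis
    proof (rule V_limit)
      show "(\<lambda>z. complex_of_real (\<phi> z)) \<in> borel_measurable BS"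
        using borel_measurable_continuous_on_restrict[OF \<phi>] by measurable
      show "V (\<lambda>z. of_real (p n z))" for n
        using V_poly[OF p V_one] by simp
      show "(\<lambda>n. complex_of_real (p n z)) \<longlonglongrightarrow> of_real (\<phi> z)" if "z \<in> S" for z
      proof (rule tendsto_of_real)
        have "(\<lambda>n. p n z - \<phi> z) \<longlonglongrightarrow> 0"
        proof (rule Lim_null_comparison)
          show "\<forall>\<^sub>F n in sequentially. norm (p n z - \<phi> z) \<le> 1 / real (Suc n)"
            using p_le[OF that]
            by (intro always_eventually allI less_imp_le) (simp add: abs_minus_commute)
          show "(\<lambda>n. 1 / real (Suc n)) \<longlonglongrightarrow> 0"
            by (rule LIMSEQ_Suc[OF lim_1_over_n])
        qed
        then show "(\<lambda>n. p n z) \<longlonglongrightarrow> \<phi> z"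
          by (rule LIM_zero_cancel)
      qed
      \<comment> \<open>The approximation error is at most 1 for every \<open>n\<close>, which gives
        a bound uniform in \<open>n\<close>.\<close>
      show "cmod (complex_of_real (p n z)) \<le> K + 1" if "z \<in> S" for n z
      proof -
        have "1 / real (Suc n) \<le> 1"
          by simp
        then show ?thesis
          using p_le[OF that, of n] K[OF that] unfolding norm_of_real by linarith
      qed
    qed
  qed
  have V_meas_ind: "indicator \<Omega> \<in> borel_measurable BS" if "\<Omega> \<in> sets borel"
    for \<Omega> :: "complex set"
    using that by (intro measurable_restrict_space1 borel_measurable_indicator)
  have V_open: "V (indicator U)" if U: "open U" for U
  \<comment> \<open>The approximants grow linearly with the distance to the complement of
    \<open>U\<close> and are cut off at 1. The whole plane is treated apart because
    \<open>infdist\<close> to the empty set is 0 by convention.\<close>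
  proof (cases "U = UNIV")
    case False
    show ?thesis
    proof (rule V_limit)
      show "V (\<lambda>z. of_real (min 1 (real n * infdist z (- U))))" for n
        by (intro V_cont continuous_intros)
      show "(\<lambda>n. complex_of_real (min 1 (real n * infdist z (- U)))) \<longlonglongrightarrow> indicator U z" for z
      proof (cases "z \<in> U")
        case True
        then have "infdist z (- U) > 0"
          using U False by (intro infdist_pos_not_in_closed) auto
        then obtain N :: nat where N: "1 < real N * infdist z (- U)"
          using ex_less_of_nat_mult by blast
        have "\<forall>\<^sub>F n in sequentially. complex_of_real (min 1 (real n * infdist z (- U))) = 1"
          using eventually_ge_at_top[of N]
        proof eventually_elim
          case (elim n)
          then have "real N * infdist z (- U) \<le> real n * infdist z (- U)"
            by (intro mult_right_mono) (auto simp: infdist_nonneg)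
          with N show ?case
            by simp
        qed
        with True show ?thesis
          by (simp add: tendsto_eventually)
      qed simp
      show "cmod (complex_of_real (min 1 (real n * infdist z (- U)))) \<le> 1" for n z
        unfolding norm_of_real by (simp add: infdist_nonneg)
    qed (use U in \<open>auto intro: V_meas_ind\<close>)
  qed (use V_one in \<open>simp add: indicator_def\<close>)
  have V_borel: "V (indicator \<Omega>)" if "\<Omega> \<in> sets borel" for \<Omega>
  proof -
    have "Int_stable {U :: complex set. open U}"
      by (auto simp: Int_stable_def)
    moreover have "{U :: complex set. open U} \<subseteq> Pow UNIV"
      by simp
    moreover have "\<Omega> \<in> sigma_sets UNIV {U. open U}"
      using that by (simp add: sets_borel)
    ultimately show ?thesis
    proof (induction rule: sigma_sets_induct_disjoint)
      case (basic U)
      then show ?case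
        by (simp add: V_open)
    next
      case empty
      show ?case
        by (rule V_open) simp
    next
      case (compl U)
      have "indicator (UNIV - U) = (\<lambda>z. 1 + (- 1) * indicator U z :: complex)"
        by (auto simp: indicator_def)
      with compl show ?case
        by (simp only:) (intro V_add V_one V_scale)
    next
      case (union U)
      have V_sum: "V (\<lambda>z. \<Sum>i<n. indicator (U i) z)" for n
      proof (induction n)
        case 0
        show ?case
          using V_scale[OF V_one, of 0] by simp
      next
        case (Suc n)
        with union show ?case
          by (simp add: V_add)
      qed
      show ?case
      proof (rule V_limit)
        \<comment> \<open>By disjointness the partial union has the sum of the indicators as its
          indicator, and it stays bounded by 1 as \<open>V_limit\<close> demands.\<close>
        show "V (indicator (\<Union>i<n. U i))" for n
        proof -
          have "indicator (\<Union>i<n. U i) = (\<lambda>z. \<Sum>i<n. indicator (U i) z :: complex)"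
            using union.hyps(1)
            by (intro ext indicator_UN_disjoint) (auto simp: disjoint_family_on_def)
          with V_sum show ?thesis
            by simp
        qed
        show "indicator (\<Union>i. U i) \<in> borel_measurable BS"
          using union.hyps(2) by (intro V_meas_ind) (auto simp: sets_borel[symmetric])
        show "cmod (indicator (\<Union>i<n. U i) z) \<le> 1" for n z
          by (simp add: indicator_def)
      qed (rule LIMSEQ_indicator_UN)
    qed
  qed
  \<comment> \<open>\<open>V\<close> only promises some integral of the indicator in
    \<open>M\<close>; by uniqueness it is \<open>E \<Omega> x\<close>.\<close>
  have E_M: "E \<Omega> x \<in> M" if \<Omega>: "\<Omega> \<in> sets borel" "\<Omega> \<subseteq> S" for \<Omega>
  proof -
    have "simple_function BS (indicator \<Omega> :: complex \<Rightarrow> complex)"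
      using that by (intro simple_function_indicator) (simp add: sets_BS_iff)
    from hsi_simple[OF this] have "hsi (indicator \<Omega>) x (E \<Omega> x)"
      by (simp add: ssi_indicator that)
    moreover obtain w where "w \<in> M" "hsi (indicator \<Omega>) x w"
      using V_borel[OF \<Omega>(1)] unfolding V_def by blast
    ultimately show ?thesis
      using hsi_unique by blast
  qed
  \<comment> \<open>\<open>V_limit\<close> cannot reach an unbounded \<open>f\<close>. The sequence
    from the definition of the integral can, since its values are combinations of vectors
    \<open>E \<Omega> x\<close>.\<close>
  obtain s where s: "\<And>n. simple_function BS (s n)" "(\<lambda>n. ssi (s n) x) \<longlonglongrightarrow> y"
    using f unfolding hsi_def by blast
  have "ssi (s n) x \<in> M" for n
    unfolding simple_spectral_integral_def using simple_BS(2)[OF s(1)]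
    by (intro complex_vector.subspace_sum[OF M(1)] complex_vector.subspace_scale[OF M(1)] E_M) auto
  then show ?thesis
    by (rule closed_sequentially[OF M(2) _ s(2)])
qed

lemma hsi_in_closure_krylov:
  assumes S: "compact S" and A: "\<And>y. hsi (\<lambda>z. z) y (A y)" and red: "krylov_reduced A x"
    and f: "hsi f x y"
  shows "y \<in> closure (krylov A x)"
proof -
  define M where "M = closure (krylov A x)"
  have "complex_vector.subspace M"
    unfolding M_def krylov_def by (intro subspace_closure complex_vector.subspace_span)
  moreover have "closed M"
    by (simp add: M_def)
  moreover have "x \<in> M"
  proof -
    have "x \<in> {(A ^^ k) x | k. True}"
      by (auto intro: exI[of _ 0])
    then have "x \<in> krylov A x"
      unfolding krylov_def by (rule complex_vector.span_base)
    then show ?thesis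
      unfolding M_def by (rule subsetD[OF closure_subset])
  qed
  moreover have A_M: "A ` M \<subseteq> M"
    using red by (simp add: krylov_reduced_def M_def)
  moreover obtain B where B: "\<And>z. z \<in> S \<Longrightarrow> cmod z \<le> B"
    using compact_imp_bounded[OF S] unfolding bounded_iff by blast
  have "cnj \<in> borel_measurable BS"
    by (intro borel_measurable_continuous_on_restrict continuous_intros)
  then have "\<exists>w. hsi cnj u w" for u
    using B by (intro hsi_bounded_exists[where B = B]) auto
  \<comment> \<open>\<open>T\<close> plays the adjoint of \<open>A\<close>: by
    \<open>hsi_adjoint\<close>, \<open>cinner (T u) w = cinner u (A w)\<close>.\<close>
  then obtain T where T: "\<And>u. hsi cnj u (T u)"
    by metis
  moreover have "T ` M \<subseteq> M"
  proof
    fix v assume "v \<in> T ` M"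
    then obtain u where u: "u \<in> M" "v = T u"
      by blast
    \<comment> \<open>Invariance of the complement keeps \<open>A w\<close> orthogonal to
      \<open>u\<close>, so \<open>T u\<close> is orthogonal to the whole complement and falls back
      into \<open>M\<close>.\<close>
    have "cinner v w = 0" if "w \<in> ortho_complement M" for w
    proof -
      have "A w \<in> ortho_complement M"
        using that red by (auto simp: krylov_reduced_def M_def ortho_complement_closure)
      then have "cinner (A w) u = 0"
        using u(1) by (simp add: ortho_complement_def)
      then have "cinner u (A w) = 0"
        by (metis cinner_commute complex_cnj_zero)
      then show ?thesis
        using hsi_adjoint[OF A T B] by (simp add: u(2))
    qed
    with \<open>complex_vector.subspace M\<close> \<open>closed M\<close> show "v \<in> M"
      by (rule double_ortho_complement)
  qed
  ultimately show ?thesis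
    unfolding M_def[symmetric] by (intro hsi_in_reducing_subspace[OF S _ _ _ A _ T _ f])
qed


section \<open>Classes of square-integrable functions\<close>

text \<open>Through this equivalence the closure of \<open>L\<^sup>2\<close> under sums and
  multiples is read off from the rules for integrals.\<close>

lemma L2_fun_iff: "f \<in> L2_fun (\<mu> x) \<longleftrightarrow> (\<exists>y. hsi f x y)"
proof -
  have "integrable (\<mu> x) (\<lambda>z. (cmod (f z))\<^sup>2) \<longleftrightarrow> (\<integral>\<^sup>+z. ennreal ((cmod (f z))\<^sup>2) \<partial>\<mu> x) < \<infinity>"
    if [measurable]: "f \<in> borel_measurable BS"
    by (simp add: integrable_iff_bounded)
  then show ?thesis
    using hsi_exists hsi_finite hsi_measurable by (auto simp: L2_fun_def measurable_\<mu>)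
qed

end

section \<open>The quotient by equality almost everywhere\<close>

lemma equiv_L2_rel: "equiv (L2_fun M) (L2_rel M)"
proof (rule equivI)
  show "L2_rel M \<subseteq> L2_fun M \<times> L2_fun M"
    by (auto simp: L2_rel_def)
  show "refl_on (L2_fun M) (L2_rel M)"
    by (auto simp: refl_on_def L2_rel_def)
  show "sym (L2_rel M)"
    by (auto simp: sym_def L2_rel_def eq_commute)
  show "trans (L2_rel M)"
  proof (rule transI)
    fix f h k assume "(f, h) \<in> L2_rel M" "(h, k) \<in> L2_rel M"
    then have "AE z in M. f z = h z" "AE z in M. h z = k z" "f \<in> L2_fun M" "k \<in> L2_fun M"
      by (auto simp: L2_rel_def)
    moreover from this(1,2) have "AE z in M. f z = k z"
      by eventually_elim simp
    ultimately show "(f, k) \<in> L2_rel M"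
      by (simp add: L2_rel_def)
  qed
qed

lemma L2_space_eq_class:
  assumes "F \<in> L2_space M" "f \<in> F"
  shows "f \<in> L2_fun M" "F = L2_rel M `` {f}"
proof -
  show f: "f \<in> L2_fun M"
    using assms in_quotient_imp_subset[OF equiv_L2_rel] unfolding L2_space_def by blast
  obtain k where k: "F = L2_rel M `` {k}"
    using assms unfolding L2_space_def by (auto elim: quotientE)
  then show "F = L2_rel M `` {f}"
    using assms(2) equiv_class_eq[OF equiv_L2_rel] by blast
qed

lemma L2_space_nonempty: "F \<in> L2_space M \<Longrightarrow> \<exists>f. f \<in> F"
  using in_quotient_imp_non_empty[OF equiv_L2_rel] unfolding L2_space_def by blast

lemma L2_class_in_space: "f \<in> L2_fun M \<Longrightarrow> L2_rel M `` {f} \<in> L2_space M"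
  unfolding L2_space_def by (rule quotientI)

lemma L2_class_self: "f \<in> L2_fun M \<Longrightarrow> f \<in> L2_rel M `` {f}"
  by (simp add: L2_rel_def)

text \<open>Equality almost everywhere is compatible with sums, so the union over all
  representatives in \<open>L2_add\<close> collapses to one class. The closure assumption is later
  discharged by \<open>hsi_add\<close>.\<close>

lemma L2_add_eq:
  assumes F: "F \<in> L2_space M" "f \<in> F" and H: "H \<in> L2_space M" "h \<in> H"
    and add: "\<And>f h. f \<in> L2_fun M \<Longrightarrow> h \<in> L2_fun M \<Longrightarrow> (\<lambda>z. f z + h z) \<in> L2_fun M"
  shows "L2_add M F H = L2_rel M `` {\<lambda>z. f z + h z}"
proof -
  have "L2_rel M `` {\<lambda>z. f' z + h' z} = L2_rel M `` {\<lambda>z. f z + h z}" if "f' \<in> F" "h' \<in> H" for f' h'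
  proof (rule equiv_class_eq[OF equiv_L2_rel])
    have "(f', f) \<in> L2_rel M" "(h', h) \<in> L2_rel M"
      using L2_space_eq_class(2)[OF F(1) that(1)] L2_space_eq_class(2)[OF H(1) that(2)] F(2) H(2)
      by auto
    then show "(\<lambda>z. f' z + h' z, \<lambda>z. f z + h z) \<in> L2_rel M"
      by (auto simp: L2_rel_def add)
  qed
  then show ?thesis
    unfolding L2_add_def using F(2) H(2) by blast
qed

lemma L2_scale_eq:
  assumes F: "F \<in> L2_space M" "f \<in> F"
    and scale: "\<And>f. f \<in> L2_fun M \<Longrightarrow> (\<lambda>z. c * f z) \<in> L2_fun M"
  shows "L2_scale M c F = L2_rel M `` {\<lambda>z. c * f z}"
proof -
  have "L2_rel M `` {\<lambda>z. c * f' z} = L2_rel M `` {\<lambda>z. c * f z}" if "f' \<in> F" for f'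
  proof (rule equiv_class_eq[OF equiv_L2_rel])
    have "(f', f) \<in> L2_rel M"
      using L2_space_eq_class(2)[OF F(1) that] F(2) by auto
    then show "(\<lambda>z. c * f' z, \<lambda>z. c * f z) \<in> L2_rel M"
      by (auto simp: L2_rel_def scale)
  qed
  then show ?thesis
    unfolding L2_scale_def using F(2) by blast
qed

theorem theorem4p1:
  fixes A :: "'a::chilbert_space \<Rightarrow> 'a" and g :: 'a
    and E :: "complex set \<Rightarrow> 'a \<Rightarrow> 'a"
  assumes "normal_operator A"
    and "spectral_measure_of A E"
    and "krylov_reduced A g"
  shows "let \<mu> = scalar_measure_on (spectrum A) E g; \<Phi> = calculus_map A E g in
      (\<forall>f\<in>L2_fun \<mu>. g \<in> spectral_calculus_domain A E f \<and>
         has_spectral_integral (spectrum A) E f g (spectral_calculus A E f g)) \<and>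
      (\<forall>F\<in>L2_space \<mu>. \<forall>f\<in>F. \<Phi> F = spectral_calculus A E f g) \<and>
      (\<forall>F\<in>L2_space \<mu>. \<forall>H\<in>L2_space \<mu>.
         L2_add \<mu> F H \<in> L2_space \<mu> \<and> \<Phi> (L2_add \<mu> F H) = \<Phi> F + \<Phi> H) \<and>
      (\<forall>c. \<forall>F\<in>L2_space \<mu>.
         L2_scale \<mu> c F \<in> L2_space \<mu> \<and> \<Phi> (L2_scale \<mu> c F) = c *\<^sub>C \<Phi> F) \<and>
      bij_betw \<Phi> (L2_space \<mu>) (closure (krylov A g))"
proof -
  have A: "bounded_clinear A"
    using assms(1) by (simp add: normal_operator_def)
  \<comment> \<open>Closedness makes the spectrum a Borel set, boundedness makes \<open>z\<close> a
    bounded multiplier, and compactness is what Stone-Weierstrass asks for.\<close>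
  have compact: "compact (spectrum A)"
    using closed_spectrum[OF A] bounded_spectrum[OF A] by (simp add: compact_eq_bounded_closed)
  interpret spectral_integration E "spectrum A"
    using assms(2) closed_spectrum[OF A]
    by unfold_locales (simp_all add: spectral_measure_of_def)
  have A_hsi: "hsi (\<lambda>z. z) y (A y)" for y
    using assms(2) by (simp add: spectral_measure_of_def)
  obtain B where B: "\<And>z. z \<in> spectrum A \<Longrightarrow> cmod z \<le> B"
    using bounded_spectrum[OF A] unfolding bounded_iff by blast
  define \<nu> where "\<nu> = scalar_measure_on (spectrum A) E g"
  define \<Phi> where "\<Phi> = calculus_map A E g"
  note L2_fun_iff' = L2_fun_iff[of _ g, folded \<nu>_def]
  have calc: "spectral_calculus A E f g = y" if "hsi f g y" for f y
    unfolding spectral_calculus_def using that hsi_unique by blast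
  have L2_hsi: "hsi f g (spectral_calculus A E f g)" if "f \<in> L2_fun \<nu>" for f
    using that calc by (auto simp: L2_fun_iff')
  have L2_add: "(\<lambda>z. f z + h z) \<in> L2_fun \<nu>" if "f \<in> L2_fun \<nu>" "h \<in> L2_fun \<nu>" for f h
    using that hsi_add unfolding L2_fun_iff' by blast
  have L2_scale: "(\<lambda>z. c * f z) \<in> L2_fun \<nu>" if "f \<in> L2_fun \<nu>" for f c
    using that hsi_scaleC unfolding L2_fun_iff' by blast
  have \<Phi>: "\<Phi> F = spectral_calculus A E f g" if "F \<in> L2_space \<nu>" "f \<in> F" for F f
  proof -
    have "spectral_calculus A E h g = spectral_calculus A E f g" if "h \<in> F" for h
    proof (rule calc, rule hsi_cong_AE)
      show "hsi f g (spectral_calculus A E f g)"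
        using L2_space_eq_class(1) \<open>F \<in> L2_space \<nu>\<close> \<open>f \<in> F\<close> by (blast intro: L2_hsi)
      have "(f, h) \<in> L2_rel \<nu>"
        using L2_space_eq_class(2)[OF \<open>F \<in> L2_space \<nu>\<close> \<open>f \<in> F\<close>] that by auto
      then have h: "h \<in> L2_fun \<nu>" and AE: "AE z in \<nu>. f z = h z"
        by (auto simp: L2_rel_def)
      show "h \<in> borel_measurable BS"
        using h hsi_measurable by (auto simp: L2_fun_iff')
      show "AE z in \<mu> g. f z = h z"
        using AE unfolding \<nu>_def .
    qed
    \<comment> \<open>The image of a class is a singleton; only then does \<open>the_elem\<close> in
      \<open>calculus_map\<close> return the common value.\<close>
    then have "(\<lambda>h. spectral_calculus A E h g) ` F = (\<lambda>_. spectral_calculus A E f g) ` F"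
      by (rule image_cong[OF refl])
    also have "\<dots> = {spectral_calculus A E f g}"
      using \<open>f \<in> F\<close> by auto
    finally show ?thesis
      by (simp add: \<Phi>_def calculus_map_def)
  qed
  have \<Phi>_class: "\<Phi> (L2_rel \<nu> `` {f}) = spectral_calculus A E f g" if "f \<in> L2_fun \<nu>" for f
    using that by (intro \<Phi> L2_class_in_space L2_class_self)
  have domain: "g \<in> spectral_calculus_domain A E f" if "f \<in> L2_fun \<nu>" for f
    using hsi_finite[OF L2_hsi[OF that]] by (simp add: spectral_calculus_domain_def)
  have add: "L2_add \<nu> F H \<in> L2_space \<nu> \<and> \<Phi> (L2_add \<nu> F H) = \<Phi> F + \<Phi> H"
    if F: "F \<in> L2_space \<nu>" and H: "H \<in> L2_space \<nu>" for F H
  proof -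
    obtain f h where f: "f \<in> F" and h: "h \<in> H"
      using L2_space_nonempty[OF F] L2_space_nonempty[OF H] by blast
    note f' = L2_space_eq_class(1)[OF F f] and h' = L2_space_eq_class(1)[OF H h]
    have "L2_add \<nu> F H = L2_rel \<nu> `` {\<lambda>z. f z + h z}"
      using F f H h by (rule L2_add_eq) (rule L2_add)
    moreover have "spectral_calculus A E (\<lambda>z. f z + h z) g
        = spectral_calculus A E f g + spectral_calculus A E h g"
      by (intro calc hsi_add L2_hsi f' h')
    ultimately show ?thesis
      using L2_add[OF f' h'] by (simp add: \<Phi>_class L2_class_in_space \<Phi>[OF F f] \<Phi>[OF H h])
  qed
  have scale: "L2_scale \<nu> c F \<in> L2_space \<nu> \<and> \<Phi> (L2_scale \<nu> c F) = c *\<^sub>C \<Phi> F"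
    if F: "F \<in> L2_space \<nu>" for F c
  proof -
    obtain f where f: "f \<in> F"
      using L2_space_nonempty[OF F] by blast
    note f' = L2_space_eq_class(1)[OF F f]
    have "L2_scale \<nu> c F = L2_rel \<nu> `` {\<lambda>z. c * f z}"
      using F f by (rule L2_scale_eq) (rule L2_scale)
    moreover have "spectral_calculus A E (\<lambda>z. c * f z) g = c *\<^sub>C spectral_calculus A E f g"
      by (intro calc hsi_scaleC L2_hsi f')
    ultimately show ?thesis
      using L2_scale[OF f'] by (simp add: \<Phi>_class L2_class_in_space \<Phi>[OF F f])
  qed
  have "bij_betw \<Phi> (L2_space \<nu>) (closure (krylov A g))"
    unfolding bij_betw_def
  proof
    show "inj_on \<Phi> (L2_space \<nu>)"
    proof (rule inj_onI)
      fix F H assume F: "F \<in> L2_space \<nu>" and H: "H \<in> L2_space \<nu>" and eq: "\<Phi> F = \<Phi> H"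
      obtain f h where f: "f \<in> F" and h: "h \<in> H"
        using L2_space_nonempty[OF F] L2_space_nonempty[OF H] by blast
      note f' = L2_space_eq_class(1)[OF F f] and h' = L2_space_eq_class(1)[OF H h]
      \<comment> \<open>By the isometry an integrand with value 0 vanishes almost everywhere, so the
        representatives agree almost everywhere.\<close>
      have "hsi (\<lambda>z. f z - h z) g 0"
        using hsi_diff[OF L2_hsi[OF f'] L2_hsi[OF h']] eq
        by (simp add: \<Phi>[OF F f] \<Phi>[OF H h])
      from hsi_eq_0_imp_AE[OF this] have "AE z in \<nu>. f z = h z"
        by (simp only: \<nu>_def right_minus_eq)
      with f' h' have "L2_rel \<nu> `` {f} = L2_rel \<nu> `` {h}"
        by (intro equiv_class_eq[OF equiv_L2_rel]) (simp add: L2_rel_def)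
      then show "F = H"
        using L2_space_eq_class(2)[OF F f] L2_space_eq_class(2)[OF H h] by simp
    qed
    show "\<Phi> ` L2_space \<nu> = closure (krylov A g)"
    proof
      show "\<Phi> ` L2_space \<nu> \<subseteq> closure (krylov A g)"
      proof (rule image_subsetI)
        fix F assume F: "F \<in> L2_space \<nu>"
        then obtain f where f: "f \<in> F"
          using L2_space_nonempty by blast
        show "\<Phi> F \<in> closure (krylov A g)"
          unfolding \<Phi>[OF F f]
          using hsi_in_closure_krylov[OF compact A_hsi assms(3)] L2_hsi[OF L2_space_eq_class(1)[OF F f]]
          by blast
      qed
      show "closure (krylov A g) \<subseteq> \<Phi> ` L2_space \<nu>"
      proof
        fix w assume "w \<in> closure (krylov A g)"
        then obtain f where f: "hsi f g w"
          using closure_krylov_subset_range[OF A_hsi B] by blast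
        then have f': "f \<in> L2_fun \<nu>"
          by (auto simp: L2_fun_iff')
        have "\<Phi> (L2_rel \<nu> `` {f}) = w"
          using \<Phi>_class[OF f'] calc[OF f] by simp
        then show "w \<in> \<Phi> ` L2_space \<nu>"
          using L2_class_in_space[OF f'] by blast
      qed
    qed
  qed
  with domain L2_hsi \<Phi> add scale show ?thesis
    unfolding Let_def \<nu>_def[symmetric] \<Phi>_def[symmetric] by blast
qed

end
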